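(* Let $\lambda_b>0$, $r_c>0$, $\alpha_c>2$, $P_t,C_c,\sigma^2>0$, $a_c,a_t>0$ with $a_c+a_t=1$, and $\gamma_c^{th}>0$ with $a_c-\gamma_c^{th}a_t>0$. Let $\Phi$ be a homogeneous Poisson point process of intensity $\lambda_b$ on $\{x\in\mathbb{R}^2:\|x\|>r_c\}$ with independent marks $H_x\sim$ Exp(1), and $I_c=\sum_{x\in\Phi}P_tC_c\|x\|^{-\alpha_c}H_x$. Let $G\sim$ Exp(1) be independent of $(\Phi,(H_x))$, and define $\gamma_c=\frac{a_cP_tC_cr_c^{-\alpha_c}G}{a_tP_tC_cr_c^{-\alpha_c}G+I_c+\sigma^2}$. Then $$\Pr\{\gamma_c>\gamma_c^{th}\}=\exp\left(-\Xi_3r_c^{\alpha_c}\right)\exp\left(-\Xi_4r_c^2\right),$$ where $\Xi_3=\frac{\gamma_c^{th}\sigma^2}{(a_c-\gamma_c^{th}a_t)P_tC_c}$ and $\Xi_4=\pi\lambda_b\left({}_2F_1\left(-\tfrac2{\alpha_c},1;1-\tfrac2{\alpha_c};-\frac{\gamma_c^{th}}{a_c-\gamma_c^{th}a_t}\right)-1\right)$, with ${}_2F_1$ the Gauss hypergeometric function.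
   Context: Interpretation: coverage probability of the connected (non-RIS-aided) NOMA user at fixed distance $r_c$ from its base station, decoding its own message while treating the partner's signal as interference; $G$ is its Rayleigh power fading, and interfering base stations lie outside radius $r_c$. (The paper writes $\Xi_3,\Xi_4$ with a factor $\eta_c=1$, which has been substituted.) *)

theory Defs
  imports "HOL-Probability.Probability"
begin

definition hyp2f1_series :: "real \<Rightarrow> real \<Rightarrow> real \<Rightarrow> real \<Rightarrow> real" where
  "hyp2f1_series a b c z =
     (\<Sum>n. pochhammer a n * pochhammer b n / pochhammer c n * z ^ n / fact n)"

text \<open>Gauss hypergeometric function 2F1(a,b;c;z) for real z < 1 (principal branch):
  the power series for abs z < 1, and its analytic continuation for z \<le> -1 given by
  the Pfaff transformation 2F1(a,b;c;z) = (1-z) powr (-a) * 2F1(a,c-b;c;z/(z-1)).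
  Values for z \<ge> 1 are not needed and left unspecified.\<close>
definition hyp2f1 :: "real \<Rightarrow> real \<Rightarrow> real \<Rightarrow> real \<Rightarrow> real" where
  "hyp2f1 a b c z =
     (if \<bar>z\<bar> < 1 then hyp2f1_series a b c z
      else if z \<le> -1 then (1 - z) powr (-a) * hyp2f1_series a (c - b) c (z / (z - 1))
      else undefined)"

definition poisson_pp :: "'a measure \<Rightarrow> 'b measure \<Rightarrow> ('a \<Rightarrow> 'b set) \<Rightarrow> bool" where
  "poisson_pp M \<mu> \<Psi> \<longleftrightarrow>
     prob_space M \<and>
     (\<forall>\<omega>\<in>space M. \<Psi> \<omega> \<subseteq> space \<mu>) \<and>
     (\<forall>B\<in>sets \<mu>. emeasure \<mu> B < \<infinity> \<longrightarrow>
        (\<forall>k::nat. {\<omega>\<in>space M. finite (\<Psi> \<omega> \<inter> B) \<and> card (\<Psi> \<omega> \<inter> B) = k} \<in> sets M \<and>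
           measure M {\<omega>\<in>space M. finite (\<Psi> \<omega> \<inter> B) \<and> card (\<Psi> \<omega> \<inter> B) = k}
             = measure \<mu> B ^ k / fact k * exp (- measure \<mu> B))) \<and>
     (\<forall>(Bs :: nat \<Rightarrow> 'b set) n.
        (\<forall>i<n. Bs i \<in> sets \<mu> \<and> emeasure \<mu> (Bs i) < \<infinity>) \<and> disjoint_family_on Bs {..<n} \<longrightarrow>
        prob_space.indep_vars M (\<lambda>_. count_space UNIV) (\<lambda>i \<omega>. card (\<Psi> \<omega> \<inter> Bs i)) {..<n})"

definition pp_counts :: "'b measure \<Rightarrow> ('a \<Rightarrow> 'b set) \<Rightarrow> 'a \<Rightarrow> 'b set \<Rightarrow> nat" where
  "pp_counts \<mu> \<Psi> \<omega> = (\<lambda>B\<in>{B\<in>sets \<mu>. emeasure \<mu> B < \<infinity>}. card (\<Psi> \<omega> \<inter> B))"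

definition pp_counts_space :: "'b measure \<Rightarrow> ('b set \<Rightarrow> nat) measure" where
  "pp_counts_space \<mu> = Pi\<^sub>M {B\<in>sets \<mu>. emeasure \<mu> B < \<infinity>} (\<lambda>_. count_space UNIV)"

text \<open>Intensity of the independently Exp(1)-marked PPP of intensity lambda_b on
  the region norm x > r_c, as a PPP on (plane x marks).\<close>
definition marked_intensity :: "real \<Rightarrow> real \<Rightarrow> ((real^2) \<times> real) measure" where
  "marked_intensity lam rc = density lborel
     (\<lambda>p. ennreal (lam * indicator {x. rc < norm x} (fst p) * exponential_density 1 (snd p)))"

end

theory Submission
  imports Defs "HOL-Real_Asymp.Real_Asymp"
begin

text \<open>Since \<^term>\<open>a_c - gth * a_t > 0\<close>, the event that the SINR exceeds the threshold is
  \<^term>\<open>G > s + Y\<close>, where \<^term>\<open>s\<close> is a constant and \<^term>\<open>Y\<close> a multiple of the interference. As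
  \<^term>\<open>G\<close> is exponential and independent of \<^term>\<open>Y\<close>, its probability is \<^term>\<open>exp (- s)\<close> times the
  Laplace transform of \<^term>\<open>Y\<close>, which the Laplace functional of the Poisson process turns into the
  integral over the plane of \<^term>\<open>k / (1 + k)\<close>, where \<^term>\<open>k = \<theta> * (R / r) powr \<alpha>\<close>. In polar coordinates
  this integrand has the antiderivative \<^term>\<open>pi * r\<^sup>2 * (1 - h k)\<close> for every solution \<^term>\<open>h\<close> of
  \<^term>\<open>t * h' - \<delta> * h = - \<delta> / (1 + t)\<close> with \<^term>\<open>h 0 = 1\<close>, where \<^term>\<open>\<delta> = 2 / \<alpha>\<close>. Both the defining
  series of the hypergeometric function and its Pfaff transform solve this equation, the latter
  on the whole half line, so no identity between the two is needed.\<close>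

subsection \<open>The hypergeometric function as a radial integral\<close>

text \<open>\<open>pochhammer x (Suc n)\<close> can be split at its first factor or at its last. The
  case \<open>x = - \<delta>\<close> occurs below, because the third hypergeometric parameter
  \<open>1 - \<delta>\<close> exceeds the first by one.\<close>

lemma pochhammer_quotient_Suc:
  fixes x :: real
  assumes "\<And>n. x + real n \<noteq> 0"
  shows "pochhammer x n / pochhammer (x + 1) n = x / (x + real n)"
proof -
  have "pochhammer x (Suc n) = x * pochhammer (x + 1) n"
    by (rule pochhammer_rec)
  moreover have "pochhammer x (Suc n) = pochhammer x n * (x + real n)"
    by (rule pochhammer_Suc)
  moreover have "pochhammer (x + 1) n \<noteq> 0"
    using assms[of "Suc _"] by (auto simp: pochhammer_eq_0_iff add_ac) (metis add.commute add.left_commute add_eq_0_iff)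
  ultimately show ?thesis
    using assms[of n] by (simp add: field_simps)
qed

text \<open>The Euler operator \<open>z * d/dz\<close> multiplies the \<open>n\<close>-th
  coefficient by \<open>n\<close>, so subtracting \<open>\<delta> * g\<close> produces the factor
  \<open>n - \<delta>\<close> that cancels the denominator. A geometric and a binomial choice of
  \<open>b\<close> give the two forms of the hypergeometric function.\<close>

lemma power_series_euler_ode:
  fixes \<delta> z :: real and b :: "nat \<Rightarrow> real" and \<phi> :: "real \<Rightarrow> real"
  assumes \<delta>: "0 < \<delta>" "\<delta> < 1"
    and b: "\<And>z. \<bar>z\<bar> < 1 \<Longrightarrow> (\<lambda>n. b n * z ^ n) sums \<phi> z"
    and z: "\<bar>z\<bar> < 1"
  defines "g \<equiv> \<lambda>z. \<Sum>n. - \<delta> / (real n - \<delta>) * b n * z ^ n"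
  shows "\<exists>D. (g has_real_derivative D) (at z) \<and> z * D - \<delta> * g z = - \<delta> * \<phi> z"
proof -
  define c where "c n = - \<delta> / (real n - \<delta>) * b n" for n
  have nz: "real n - \<delta> \<noteq> 0" for n
    using \<delta> by (cases n) auto
  \<comment> \<open>The factor is 1 at \<open>n = 0\<close> and at most
    \<open>\<delta> / (1 - \<delta>)\<close> in absolute value afterwards; being bounded, it
    preserves absolute convergence.\<close>
  have cb: "\<bar>- \<delta> / (real n - \<delta>)\<bar> \<le> max 1 (\<delta> / (1 - \<delta>))" for n
  proof (cases n)
    case (Suc m)
    hence "\<bar>- \<delta> / (real n - \<delta>)\<bar> = \<delta> / (real n - \<delta>)" using \<delta> by simp
    also have "\<dots> \<le> \<delta> / (1 - \<delta>)" using Suc \<delta> by (intro divide_left_mono) auto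
    finally show ?thesis by simp
  qed (use \<delta> in auto)
  have sm: "summable (\<lambda>n. c n * w ^ n)" if w: "\<bar>w\<bar> < 1" for w
  proof -
    \<comment> \<open>For \<open>b\<close> only convergence at each point of the disc is assumed;
      absolute convergence at \<open>w\<close> comes from convergence at a point \<open>v\<close>
      further out.\<close>
    define v where "v = (\<bar>w\<bar> + 1) / 2"
    have v: "\<bar>w\<bar> < v" "\<bar>v\<bar> < 1" using w by (auto simp: v_def)
    have "summable (\<lambda>n. norm (b n * w ^ n))"
      by (rule powser_insidea[OF sums_summable[OF b[OF v(2)]]]) (use v in auto)
    hence s: "summable (\<lambda>n. max 1 (\<delta> / (1 - \<delta>)) * norm (b n * w ^ n))"
      by (rule summable_mult)
    show ?thesis
    proof (rule summable_comparison_test'[OF s])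
      fix n
      have "norm (c n * w ^ n) = \<bar>- \<delta> / (real n - \<delta>)\<bar> * norm (b n * w ^ n)"
        by (simp add: c_def abs_mult)
      also have "\<dots> \<le> max 1 (\<delta> / (1 - \<delta>)) * norm (b n * w ^ n)"
        by (intro mult_right_mono cb) auto
      finally show "norm (c n * w ^ n) \<le> max 1 (\<delta> / (1 - \<delta>)) * norm (b n * w ^ n)" .
    qed
  qed
  have g: "g = (\<lambda>z. \<Sum>n. c n * z ^ n)" by (simp add: g_def c_def)
  have D: "(g has_real_derivative (\<Sum>n. diffs c n * z ^ n)) (at z)"
    unfolding g by (rule termdiffs_strong'[of 1]) (use sm z in auto)
  have "summable (\<lambda>n. diffs c n * z ^ n)"
    by (rule termdiff_converges[of _ 1]) (use sm z in auto)
  from sums_mult[OF summable_sums[OF this], of z]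
  have "(\<lambda>n. real (Suc n) * c (Suc n) * z ^ Suc n) sums (z * (\<Sum>n. diffs c n * z ^ n))"
    by (simp add: diffs_def mult_ac)
  \<comment> \<open>The term at \<open>n = 0\<close> carries the factor 0, so the index shift costs
    nothing.\<close>
  hence "(\<lambda>n. real n * c n * z ^ n) sums (z * (\<Sum>n. diffs c n * z ^ n))"
    using sums_Suc_iff[of "\<lambda>n. real n * c n * z ^ n"] by simp
  moreover have "(\<lambda>n. c n * z ^ n) sums g z"
    unfolding g using sm[OF z] by (rule summable_sums)
  ultimately have "(\<lambda>n. real n * c n * z ^ n - \<delta> * (c n * z ^ n)) sums
      (z * (\<Sum>n. diffs c n * z ^ n) - \<delta> * g z)"
    by (intro sums_diff sums_mult)
  also have "(\<lambda>n. real n * c n * z ^ n - \<delta> * (c n * z ^ n)) = (\<lambda>n. - \<delta> * (b n * z ^ n))"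
  proof
    fix n
    have "real n * c n * z ^ n - \<delta> * (c n * z ^ n) = (real n - \<delta>) * c n * z ^ n"
      by (simp add: algebra_simps)
    also have "(real n - \<delta>) * c n = - \<delta> * b n" using nz[of n] by (simp add: c_def)
    finally show "real n * c n * z ^ n - \<delta> * (c n * z ^ n) = - \<delta> * (b n * z ^ n)" by simp
  qed
  finally have "z * (\<Sum>n. diffs c n * z ^ n) - \<delta> * g z = - \<delta> * \<phi> z"
    using sums_mult[OF b[OF z], of "-\<delta>"] by (rule sums_unique2)
  with D show ?thesis by blast
qed

text \<open>Since \<open>pochhammer 1 n\<close> cancels the factorial, this is the case
  \<open>b = 1\<close>, where \<open>\<phi>\<close> is the geometric series. Replacing
  \<open>z\<close> by \<open>- t\<close> leaves the Euler operator unchanged.\<close>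

lemma hyp2f1_series_ode:
  fixes \<delta> t :: real
  assumes \<delta>: "0 < \<delta>" "\<delta> < 1" and t: "\<bar>t\<bar> < 1"
  defines "h \<equiv> \<lambda>t. hyp2f1_series (- \<delta>) 1 (1 - \<delta>) (- t)"
  shows "\<exists>D. (h has_real_derivative D) (at t) \<and> t * D - \<delta> * h t = - \<delta> / (1 + t)"
proof -
  have nz: "- \<delta> + real n \<noteq> 0" for n using \<delta> by (cases n) auto
  have coeff: "pochhammer (- \<delta>) n * pochhammer 1 n / pochhammer (1 - \<delta>) n * z ^ n / fact n
      = - \<delta> / (real n - \<delta>) * 1 * z ^ n" for n z
  proof -
    have "pochhammer (- \<delta>) n * pochhammer 1 n / pochhammer (1 - \<delta>) n * z ^ n / fact n
        = pochhammer (- \<delta>) n / pochhammer (- \<delta> + 1) n * z ^ n"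
      by (simp add: pochhammer_fact[symmetric])
    thus ?thesis unfolding pochhammer_quotient_Suc[OF nz] by simp
  qed
  have geo: "(\<lambda>n. 1 * z ^ n) sums (1 / (1 - z))" if "\<bar>z\<bar> < 1" for z :: real
    using geometric_sums[of z] that by simp
  define g where "g z = (\<Sum>n. - \<delta> / (real n - \<delta>) * 1 * z ^ n)" for z
  have h: "h = (\<lambda>t. g (- t))"
    unfolding h_def hyp2f1_series_def coeff g_def ..
  have "\<exists>D. (g has_real_derivative D) (at (- t)) \<and> (- t) * D - \<delta> * g (- t) = - \<delta> * (1 / (1 - (- t)))"
    unfolding g_def[abs_def]
    by (rule power_series_euler_ode[where b = "\<lambda>_. 1" and \<phi> = "\<lambda>z. 1 / (1 - z)", OF \<delta> geo])
      (use t in auto)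
  then obtain D where D: "(g has_real_derivative D) (at (- t))"
      "(- t) * D - \<delta> * g (- t) = - \<delta> * (1 / (1 - (- t)))"
    by blast
  show ?thesis
  proof (intro exI conjI)
    have "((\<lambda>t. g (- t)) has_real_derivative D * (- 1)) (at t)"
      by (rule DERIV_chain2[where f = g and g = uminus, OF D(1)]) (auto intro!: derivative_eq_intros)
    thus "(h has_real_derivative - D) (at t)" by (simp add: h)
    show "t * - D - \<delta> * h t = - \<delta> / (1 + t)" using D(2) by (simp add: h)
  qed
qed

text \<open>\<open>h\<close> is the Pfaff form at \<open>z = - t\<close>, whose argument
  \<open>t / (1 + t)\<close> stays in the unit disc for all \<open>t \<ge> 0\<close>. Here
  \<open>\<phi>\<close> is the binomial series of \<open>(1 - w) powr \<delta>\<close>, and the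
  prefactor \<open>(1 + t) powr \<delta>\<close> is its reciprocal, which is why the same equation
  results.\<close>

lemma hyp2f1_pfaff_ode:
  fixes \<delta> t :: real
  assumes \<delta>: "0 < \<delta>" "\<delta> < 1" and t: "0 \<le> t"
  defines "h \<equiv> \<lambda>t. (1 + t) powr \<delta> * hyp2f1_series (- \<delta>) (- \<delta>) (1 - \<delta>) (t / (1 + t))"
  shows "\<exists>D. (h has_real_derivative D) (at t) \<and> t * D - \<delta> * h t = - \<delta> / (1 + t)"
proof -
  define b where "b n = pochhammer (- \<delta>) n / fact n" for n
  have nz: "- \<delta> + real n \<noteq> 0" for n using \<delta> by (cases n) auto
  have coeff: "pochhammer (- \<delta>) n * pochhammer (- \<delta>) n / pochhammer (1 - \<delta>) n * z ^ n / fact n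
      = - \<delta> / (real n - \<delta>) * b n * z ^ n" for n z
  proof -
    have "pochhammer (- \<delta>) n * pochhammer (- \<delta>) n / pochhammer (1 - \<delta>) n * z ^ n / fact n
        = pochhammer (- \<delta>) n / pochhammer (- \<delta> + 1) n * b n * z ^ n"
      by (simp add: b_def)
    thus ?thesis unfolding pochhammer_quotient_Suc[OF nz] by simp
  qed
  have binom: "(\<lambda>n. b n * z ^ n) sums ((1 - z) powr \<delta>)" if "\<bar>z\<bar> < 1" for z :: real
  proof -
    have "(\<lambda>n. (\<delta> gchoose n) * (- z) ^ n) sums (1 + (- z)) powr \<delta>"
      by (rule gen_binomial_real) (use that in auto)
    moreover have "(\<delta> gchoose n) * (- z) ^ n = b n * z ^ n" for n
      by (simp add: gbinomial_pochhammer b_def power_minus[of z] mult_ac)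
    ultimately show ?thesis by simp
  qed
  define g where "g z = (\<Sum>n. - \<delta> / (real n - \<delta>) * b n * z ^ n)" for z
  have h: "h = (\<lambda>t. (1 + t) powr \<delta> * g (t / (1 + t)))"
    unfolding h_def hyp2f1_series_def coeff g_def ..
  define w where "w = t / (1 + t)"
  have w: "\<bar>w\<bar> < 1" using t by (simp add: w_def)
  have "\<exists>D. (g has_real_derivative D) (at w) \<and> w * D - \<delta> * g w = - \<delta> * (1 - w) powr \<delta>"
    unfolding g_def[abs_def]
    by (rule power_series_euler_ode[where b = b and \<phi> = "\<lambda>z. (1 - z) powr \<delta>", OF \<delta> binom w])
  then obtain D where D: "(g has_real_derivative D) (at w)" "w * D - \<delta> * g w = - \<delta> * (1 - w) powr \<delta>"
    by blast
  define E where "E = \<delta> * (1 + t) powr (\<delta> - 1) * g w + (1 + t) powr \<delta> * (D / (1 + t)\<^sup>2)"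
  show ?thesis
  proof (intro exI conjI)
    have "((\<lambda>t. t / (1 + t)) has_real_derivative 1 / (1 + t)\<^sup>2) (at t)"
      using t by (auto intro!: derivative_eq_intros simp: power2_eq_square)
    hence dg: "((\<lambda>t. g (t / (1 + t))) has_real_derivative D * (1 / (1 + t)\<^sup>2)) (at t)"
      using D(1) unfolding w_def by (rule DERIV_chain2[where f = g and g = "\<lambda>t. t / (1 + t)", rotated])
    have "((\<lambda>t. (1 + t) powr \<delta>) has_real_derivative \<delta> * (1 + t) powr (\<delta> - of_nat 1) * 1) (at t)"
      by (rule DERIV_fun_powr) (use t in \<open>auto intro!: derivative_eq_intros\<close>)
    from DERIV_mult[OF this dg] show "(h has_real_derivative E) (at t)"
      by (simp add: h E_def w_def mult_ac)
    have p: "(1 + t) powr (\<delta> - 1) = (1 + t) powr \<delta> / (1 + t)"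
      using t by (simp add: powr_diff)
    have q: "(1 - w) powr \<delta> * (1 + t) powr \<delta> = 1"
    proof -
      have "1 - w = 1 / (1 + t)" using t by (simp add: w_def field_simps)
      thus ?thesis using t by (simp add: powr_divide)
    qed
    have "t * E - \<delta> * h t = (1 + t) powr \<delta> * (t * \<delta> * g w / (1 + t) + t * D / (1 + t)\<^sup>2 - \<delta> * g w)"
      by (simp add: E_def h p w_def[symmetric] algebra_simps)
    \<comment> \<open>As \<open>w = t / (1 + t)\<close>, the terms in \<open>g w\<close> combine to
      \<open>- \<delta> * g w / (1 + t)\<close>, leaving the Euler expression of \<open>g\<close> at
      \<open>w\<close>, divided by \<open>1 + t\<close>.\<close>
    also have "t * \<delta> * g w / (1 + t) + t * D / (1 + t)\<^sup>2 - \<delta> * g w = (w * D - \<delta> * g w) / (1 + t)"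
      using t unfolding w_def by (simp add: divide_simps) (simp add: algebra_simps power2_eq_square)
    also have "(1 + t) powr \<delta> * ((w * D - \<delta> * g w) / (1 + t)) = - \<delta> * ((1 - w) powr \<delta> * (1 + t) powr \<delta>) / (1 + t)"
      unfolding D(2) by simp
    finally show "t * E - \<delta> * h t = - \<delta> / (1 + t)" unfolding q by simp
  qed
qed

lemma hyp2f1_series_0: "hyp2f1_series a b c 0 = 1"
  using powser_zero[of "\<lambda>n. pochhammer a n * pochhammer b n / pochhammer c n / fact n"]
  by (simp add: hyp2f1_series_def)

text \<open>Since \<open>r * k' = - \<alpha> * k\<close>, the chain rule and the equation for
  \<open>h\<close> give \<open>2 * pi * r * (1 - 1 / (1 + k r))\<close> as the derivative of
  \<open>F\<close>. For \<open>r \<ge> R\<close> the argument \<open>k r\<close> stays in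
  \<open>(0, \<theta>]\<close>, with \<open>k R = \<theta>\<close> at the inner boundary.\<close>

lemma nn_integral_radial_kernel:
  fixes R \<alpha> \<theta> D0 :: real and h :: "real \<Rightarrow> real"
  assumes R: "R > 0" and \<alpha>: "\<alpha> > 2" and \<theta>: "\<theta> > 0"
    and ode: "\<And>t. 0 < t \<Longrightarrow> t \<le> \<theta> \<Longrightarrow>
      \<exists>D. (h has_real_derivative D) (at t) \<and> t * D - 2 / \<alpha> * h t = - (2 / \<alpha>) / (1 + t)"
    and h0: "(h has_real_derivative D0) (at 0)" "h 0 = 1"
  defines "k \<equiv> \<lambda>r. \<theta> * (R / r) powr \<alpha>"
  shows "(\<integral>\<^sup>+r. ennreal (2 * pi * r * (k r / (1 + k r))) * indicator {R..} r \<partial>lborel)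
      = ennreal (pi * R\<^sup>2 * (h \<theta> - 1))" and "h \<theta> \<ge> 1"
proof -
  define F where "F r = pi * r\<^sup>2 * (1 - h (k r))" for r
  define f where "f r = 2 * pi * r * (k r / (1 + k r))" for r
  have k: "0 < k r" "k r \<le> \<theta>" if "R \<le> r" for r
  proof -
    have "0 < R / r" "R / r \<le> 1" using that R by auto
    thus "0 < k r" "k r \<le> \<theta>" using \<theta> \<alpha> R that by (auto simp: k_def powr_le1 mult_le_cancel_left1)
  qed
  have kR: "k R = \<theta>" using R by (simp add: k_def)
  have f0: "0 \<le> f r" if "R \<le> r" for r
    using k[OF that] that R by (auto simp: f_def intro!: mult_nonneg_nonneg divide_nonneg_nonneg)
  have dF: "DERIV F r :> f r" if r: "R \<le> r" for r
  proof -
    from r R have r0: "r > 0" by simp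
    obtain D where D: "(h has_real_derivative D) (at (k r))"
        "k r * D - 2 / \<alpha> * h (k r) = - (2 / \<alpha>) / (1 + k r)"
      using ode[OF k[OF r]] by blast
    have "((\<lambda>r. (R / r) powr \<alpha>) has_real_derivative - \<alpha> * (R / r) powr \<alpha> / r) (at r)"
    proof -
      have "((\<lambda>r. (R / r) powr \<alpha>) has_real_derivative
          \<alpha> * (R / r) powr (\<alpha> - of_nat 1) * (- R / (r * r))) (at r)"
        by (rule DERIV_fun_powr) (use r0 R in \<open>auto intro!: derivative_eq_intros\<close>)
      moreover have e: "(R / r) powr (\<alpha> - of_nat 1) = (R / r) powr \<alpha> * r / R"
        using r0 R by (simp add: powr_diff)
      have "\<alpha> * (R / r) powr (\<alpha> - of_nat 1) * (- R / (r * r)) = - \<alpha> * (R / r) powr \<alpha> / r"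
        unfolding e using r0 R by (simp add: field_simps)
      ultimately show ?thesis by (simp only:)
    qed
    hence dk: "(k has_real_derivative - \<alpha> * k r / r) (at r)"
      unfolding k_def by (rule DERIV_cong[OF DERIV_cmult]) simp
    have dh: "((\<lambda>r. h (k r)) has_real_derivative D * (- \<alpha> * k r / r)) (at r)"
      by (rule DERIV_chain2[where f = h and g = k, OF D(1) dk])
    have "(F has_real_derivative 2 * pi * r * (1 - h (k r)) - pi * r\<^sup>2 * (D * (- \<alpha> * k r / r))) (at r)"
      unfolding F_def[abs_def]
      by (rule derivative_eq_intros dh refl)+ (simp add: algebra_simps)
    also have "2 * pi * r * (1 - h (k r)) - pi * r\<^sup>2 * (D * (- \<alpha> * k r / r))
        = 2 * pi * r * (1 - h (k r)) + pi * r * \<alpha> * (k r * D)"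
      using r0 by (simp add: power2_eq_square)
    also have "k r * D = 2 / \<alpha> * h (k r) - (2 / \<alpha>) / (1 + k r)"
      using D(2) by simp
    also have "2 * pi * r * (1 - h (k r)) + pi * r * \<alpha> * (2 / \<alpha> * h (k r) - (2 / \<alpha>) / (1 + k r)) = f r"
    proof -
      have "\<alpha> * (2 / \<alpha> * h (k r) - (2 / \<alpha>) / (1 + k r)) = 2 * h (k r) - 2 / (1 + k r)"
        using \<alpha> by (simp add: right_diff_distrib)
      hence "pi * r * \<alpha> * (2 / \<alpha> * h (k r) - (2 / \<alpha>) / (1 + k r)) = pi * r * (2 * h (k r) - 2 / (1 + k r))"
        by (simp only: mult.assoc)
      moreover have "1 - 1 / (1 + k r) = k r / (1 + k r)" using k[OF r] by (simp add: field_simps)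
      hence "2 * pi * r * (1 - 1 / (1 + k r)) = f r" by (simp add: f_def)
      ultimately show ?thesis by (simp add: algebra_simps)
    qed
    finally show ?thesis .
  qed
  \<comment> \<open>\<open>F r\<close> is \<open>- pi * r^2 * k r\<close> times the difference
    quotient of \<open>h\<close> at 0. The quotient tends to \<open>D0\<close>, while
    \<open>r^2 * k r\<close> is a multiple of \<open>r powr (2 - \<alpha>)\<close>, which vanishes
    at infinity because \<open>\<alpha> > 2\<close>.\<close>
  have lim: "(F \<longlongrightarrow> 0) at_top"
  proof -
    have k0: "(k \<longlongrightarrow> 0) at_top"
      unfolding k_def using R \<alpha> \<theta> by real_asymp
    have "filterlim k (at 0) at_top"
      unfolding filterlim_at using k0 k
      by (auto intro!: eventually_mono[OF eventually_ge_at_top[of R]] less_imp_neq[symmetric])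
    moreover have "((\<lambda>t. (h t - 1) / t) \<longlongrightarrow> D0) (at 0)"
      using h0 by (simp add: has_field_derivative_iff)
    ultimately have "((\<lambda>r. (h (k r) - 1) / k r) \<longlongrightarrow> D0) at_top"
      by (rule filterlim_compose[rotated])
    moreover have "((\<lambda>r. - pi * (r\<^sup>2 * k r)) \<longlongrightarrow> 0) at_top"
      unfolding k_def using R \<alpha> \<theta> by real_asymp
    ultimately have "((\<lambda>r. - pi * (r\<^sup>2 * k r) * ((h (k r) - 1) / k r)) \<longlongrightarrow> 0 * D0) at_top"
      by (rule tendsto_mult[rotated])
    hence "((\<lambda>r. - pi * (r\<^sup>2 * k r) * ((h (k r) - 1) / k r)) \<longlongrightarrow> 0) at_top" by simp
    thus ?thesis
    proof (rule Lim_transform_eventually)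
      show "\<forall>\<^sub>F r in at_top. - pi * (r\<^sup>2 * k r) * ((h (k r) - 1) / k r) = F r"
        using eventually_ge_at_top[of R]
      proof eventually_elim
        case (elim r)
        thus ?case using k(1)[of r] by (simp add: F_def field_simps)
      qed
    qed
  qed
  have fb: "f \<in> borel_measurable borel" unfolding f_def k_def by measurable
  have "(\<integral>\<^sup>+r. ennreal (f r) * indicator {R..} r \<partial>lborel) = ennreal (0 - F R)"
    by (rule nn_integral_FTC_atLeast[OF fb dF f0 lim])
  thus "(\<integral>\<^sup>+r. ennreal (2 * pi * r * (k r / (1 + k r))) * indicator {R..} r \<partial>lborel)
      = ennreal (pi * R\<^sup>2 * (h \<theta> - 1))"
    by (simp add: f_def F_def kR algebra_simps)
  \<comment> \<open>\<open>F\<close> increases to its limit 0, so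
    \<open>F R = pi * R^2 * (1 - h \<theta>)\<close> cannot be positive.\<close>
  have "F R \<le> 0"
  proof (rule tendsto_lowerbound[OF lim])
    show "\<forall>\<^sub>F r in at_top. F R \<le> F r"
      using eventually_ge_at_top[of R]
    proof eventually_elim
      case (elim r)
      show ?case
        by (rule DERIV_nonneg_imp_nondecreasing[OF elim]) (use dF f0 in blast)
    qed
  qed simp
  thus "h \<theta> \<ge> 1" using R pi_gt_zero by (auto simp: F_def kR mult_le_0_iff)
qed

text \<open>It suffices to have one solution \<open>h\<close> of the equation on all of
  \<open>(0, \<theta>]\<close> whose value at \<open>\<theta>\<close> is that of
  \<open>hyp2f1\<close>. Which of the two defining formulas supplies it depends on whether
  \<open>\<theta> < 1\<close>.\<close>

lemma nn_integral_radial_hyp2f1: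
  fixes R \<alpha> \<theta> :: real
  assumes R: "R > 0" and \<alpha>: "\<alpha> > 2" and \<theta>: "\<theta> > 0"
  defines "k \<equiv> \<lambda>r. \<theta> * (R / r) powr \<alpha>"
    and "H \<equiv> hyp2f1 (- 2 / \<alpha>) 1 (1 - 2 / \<alpha>) (- \<theta>)"
  shows "(\<integral>\<^sup>+r. ennreal (2 * pi * r * (k r / (1 + k r))) * indicator {R..} r \<partial>lborel)
      = ennreal (pi * R\<^sup>2 * (H - 1))" and "H \<ge> 1"
proof -
  define \<delta> where "\<delta> = 2 / \<alpha>"
  have \<delta>: "0 < \<delta>" "\<delta> < 1" using \<alpha> by (auto simp: \<delta>_def)
  define hs hp where "hs t = hyp2f1_series (- \<delta>) 1 (1 - \<delta>) (- t)"
    and "hp t = (1 + t) powr \<delta> * hyp2f1_series (- \<delta>) (- \<delta>) (1 - \<delta>) (t / (1 + t))" for t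
  have s: "\<exists>D. (hs has_real_derivative D) (at t) \<and> t * D - \<delta> * hs t = - \<delta> / (1 + t)"
    if "\<bar>t\<bar> < 1" for t
    unfolding hs_def[abs_def] by (rule hyp2f1_series_ode[OF \<delta> that])
  have p: "\<exists>D. (hp has_real_derivative D) (at t) \<and> t * D - \<delta> * hp t = - \<delta> / (1 + t)"
    if "0 \<le> t" for t
    unfolding hp_def[abs_def] by (rule hyp2f1_pfaff_ode[OF \<delta> that])
  have s0: "hs 0 = 1" and p0: "hp 0 = 1" by (simp_all add: hs_def hp_def hyp2f1_series_0)
  have "\<exists>h D0. H = h \<theta> \<and> h 0 = 1 \<and> (h has_real_derivative D0) (at 0) \<and>
     (\<forall>t. 0 < t \<and> t \<le> \<theta> \<longrightarrow> (\<exists>D. (h has_real_derivative D) (at t) \<and> t * D - \<delta> * h t = - \<delta> / (1 + t)))"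
  proof (cases "\<theta> < 1")
    case True
    obtain D0 where "(hs has_real_derivative D0) (at 0)" using s[of 0] by auto
    moreover have "H = hs \<theta>" using True \<theta> by (simp add: H_def hyp2f1_def hs_def \<delta>_def)
    ultimately show ?thesis using s s0 True by (intro exI[of _ hs] exI[of _ D0]) auto
  next
    \<comment> \<open>The Pfaff form serves on the whole of \<open>(0, \<theta>]\<close>, even below
      1 where \<open>hyp2f1\<close> is defined by the series; only at \<open>\<theta>\<close> must
      \<open>hp\<close> agree with \<open>hyp2f1\<close>.\<close>
    case False
    obtain D0 where "(hp has_real_derivative D0) (at 0)" using p[of 0] by auto
    moreover have "- \<theta> / (- \<theta> - 1) = \<theta> / (1 + \<theta>)"
      using \<theta> by (simp add: divide_simps) (simp add: algebra_simps)
    hence "H = hp \<theta>" using False \<theta> by (simp add: H_def hyp2f1_def hp_def \<delta>_def)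
    ultimately show ?thesis using p p0 by (intro exI[of _ hp] exI[of _ D0]) auto
  qed
  then obtain h D0 where H: "H = h \<theta>" and h0: "(h has_real_derivative D0) (at 0)" "h 0 = 1"
    and ode: "\<And>t. 0 < t \<Longrightarrow> t \<le> \<theta> \<Longrightarrow>
       \<exists>D. (h has_real_derivative D) (at t) \<and> t * D - 2 / \<alpha> * h t = - (2 / \<alpha>) / (1 + t)"
    unfolding \<delta>_def by blast
  show "(\<integral>\<^sup>+r. ennreal (2 * pi * r * (k r / (1 + k r))) * indicator {R..} r \<partial>lborel)
      = ennreal (pi * R\<^sup>2 * (H - 1))"
    unfolding k_def H by (rule nn_integral_radial_kernel(1)[OF R \<alpha> \<theta> ode h0])
  show "H \<ge> 1" unfolding H by (rule nn_integral_radial_kernel(2)[OF R \<alpha> \<theta> ode h0])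
qed

text \<open>Near 0 the function is its power series, which is differentiable there. The limit serves
  later to exclude infinite interference.\<close>

lemma hyp2f1_tendsto_1:
  assumes "\<alpha> > 2"
  shows "((\<lambda>\<theta>. hyp2f1 (- 2 / \<alpha>) 1 (1 - 2 / \<alpha>) (- \<theta>)) \<longlongrightarrow> 1) (at 0)"
proof -
  define \<delta> where "\<delta> = 2 / \<alpha>"
  have \<delta>: "0 < \<delta>" "\<delta> < 1" using assms by (auto simp: \<delta>_def)
  define hs where "hs t = hyp2f1_series (- \<delta>) 1 (1 - \<delta>) (- t)" for t
  obtain D where "(hs has_real_derivative D) (at 0)"
    using hyp2f1_series_ode[OF \<delta>, of 0] unfolding hs_def[abs_def] by auto
  hence "isCont hs 0" by (rule DERIV_isCont)
  hence "(hs \<longlongrightarrow> 1) (at 0)" by (simp add: isCont_def hs_def hyp2f1_series_0)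
  moreover have "\<forall>\<^sub>F \<theta> in at 0. hs \<theta> = hyp2f1 (- 2 / \<alpha>) 1 (1 - 2 / \<alpha>) (- \<theta>)"
    unfolding eventually_at by (intro exI[of _ 1]) (auto simp: hyp2f1_def hs_def \<delta>_def)
  ultimately show ?thesis by (rule Lim_transform_eventually)
qed

subsection \<open>Laplace functional of a Poisson process\<close>

text \<open>The value 0 at \<open>\<top>\<close> makes this the continuous extension of
  \<open>exp (- x)\<close>, so the Laplace functional covers point sums before they are known to be
  finite.\<close>

definition exp_neg :: "ennreal \<Rightarrow> real" where
  "exp_neg x = (if x = \<top> then 0 else exp (- enn2real x))"

lemma exp_neg_ennreal: "0 \<le> x \<Longrightarrow> exp_neg (ennreal x) = exp (- x)"
  by (simp add: exp_neg_def)

lemma exp_neg_0 [simp]: "exp_neg 0 = 1"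
  by (simp add: exp_neg_def)

lemma exp_neg_nonneg [simp]: "0 \<le> exp_neg x"
  by (simp add: exp_neg_def)

lemma exp_neg_le_1 [simp]: "exp_neg x \<le> 1"
  by (simp add: exp_neg_def)

lemma measurable_exp_neg [measurable]: "exp_neg \<in> borel_measurable borel"
  unfolding exp_neg_def[abs_def] by measurable

lemma exp_neg_antimono:
  assumes "x \<le> y"
  shows "exp_neg y \<le> exp_neg x"
proof (cases "y = \<top>")
  case False
  hence "x \<noteq> \<top>" using assms by (auto simp: top_unique)
  moreover have "enn2real x \<le> enn2real y"
    using assms False by (intro enn2real_mono) (auto simp: less_top)
  ultimately show ?thesis using False by (simp add: exp_neg_def)
qed (simp add: exp_neg_def)

lemma tendsto_exp_neg:
  assumes "(u \<longlongrightarrow> l) F"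
  shows "((\<lambda>n. exp_neg (u n)) \<longlongrightarrow> exp_neg l) F"
proof (cases l)
  case (real r)
  have "\<forall>\<^sub>F n in F. u n < \<top>"
    by (rule order_tendstoD(2)[OF assms]) (simp add: real)
  moreover have "((\<lambda>n. exp (- enn2real (u n))) \<longlongrightarrow> exp_neg l) F"
    using real assms by (auto simp: exp_neg_ennreal intro!: tendsto_intros)
  moreover have "\<forall>\<^sub>F n in F. exp (- enn2real (u n)) = exp_neg (u n)"
    using calculation(1) by eventually_elim (simp add: exp_neg_def)
  ultimately show ?thesis by (blast intro: Lim_transform_eventually)
next
  case top
  have "((\<lambda>n. exp_neg (u n)) \<longlongrightarrow> 0) F"
  proof (rule order_tendstoI)
    fix a :: real assume "a < 0"
    thus "\<forall>\<^sub>F n in F. a < exp_neg (u n)"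
      by (intro always_eventually allI) (rule less_le_trans[OF _ exp_neg_nonneg])
  next
    fix a :: real assume a: "0 < a"
    \<comment> \<open>The term \<open>1 - ln a\<close> forces \<open>exp (- K) < a\<close>; the
      maximum with 0 keeps \<open>ennreal K\<close> from truncating.\<close>
    define K where "K = max 0 (1 - ln a)"
    have "\<forall>\<^sub>F n in F. ennreal K < u n"
      by (rule order_tendstoD(1)[OF assms]) (simp add: top)
    thus "\<forall>\<^sub>F n in F. exp_neg (u n) < a"
    proof eventually_elim
      case (elim n)
      have "exp_neg (u n) \<le> exp_neg (ennreal K)"
        by (rule exp_neg_antimono) (use elim in simp)
      also have "\<dots> = exp (- K)" by (rule exp_neg_ennreal) (simp add: K_def)
      also have "\<dots> < exp (ln a)" by (auto simp: K_def max_def)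
      finally show ?case using a by simp
    qed
  qed
  thus ?thesis by (simp add: top exp_neg_def)
qed

section \<open>Approximation of nonnegative functions by step functions of finite measure\<close>

definition finite_steps :: "'b measure \<Rightarrow> nat \<Rightarrow> (nat \<Rightarrow> real) \<Rightarrow> (nat \<Rightarrow> 'b set) \<Rightarrow> bool" where
  "finite_steps \<mu> n c B \<longleftrightarrow>
     (\<forall>i<n. 0 \<le> c i \<and> B i \<in> sets \<mu> \<and> emeasure \<mu> (B i) < \<infinity>) \<and> disjoint_family_on B {..<n}"

definition step_fun :: "nat \<Rightarrow> (nat \<Rightarrow> real) \<Rightarrow> (nat \<Rightarrow> 'b set) \<Rightarrow> 'b \<Rightarrow> ennreal" where
  "step_fun n c B x = (\<Sum>i<n. ennreal (c i) * indicator (B i) x)"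

text \<open>Convergence is at every point of the space and not just almost everywhere, since point
  sums evaluate \<open>f\<close> at single points, which may be null sets.\<close>

definition step_approx ::
    "'b measure \<Rightarrow> (nat \<Rightarrow> nat) \<Rightarrow> (nat \<Rightarrow> nat \<Rightarrow> real) \<Rightarrow> (nat \<Rightarrow> nat \<Rightarrow> 'b set) \<Rightarrow> ('b \<Rightarrow> ennreal) \<Rightarrow> bool" where
  "step_approx \<mu> n c B f \<longleftrightarrow>
     (\<forall>m. finite_steps \<mu> (n m) (c m) (B m)) \<and>
     (\<forall>x\<in>space \<mu>. (\<forall>m. step_fun (n m) (c m) (B m) x \<le> step_fun (n (Suc m)) (c (Suc m)) (B (Suc m)) x) \<and>
        (\<lambda>m. step_fun (n m) (c m) (B m) x) \<longlonglongrightarrow> f x)"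

lemma step_approxD:
  assumes "step_approx \<mu> n c B f"
  shows "finite_steps \<mu> (n m) (c m) (B m)"
    and "x \<in> space \<mu> \<Longrightarrow> step_fun (n m) (c m) (B m) x \<le> step_fun (n (Suc m)) (c (Suc m)) (B (Suc m)) x"
    and "x \<in> space \<mu> \<Longrightarrow> (\<lambda>m. step_fun (n m) (c m) (B m) x) \<longlonglongrightarrow> f x"
  using assms by (auto simp: step_approx_def)

lemma measurable_step_fun:
  "finite_steps \<mu> n c B \<Longrightarrow> step_fun n c B \<in> borel_measurable \<mu>"
  unfolding step_fun_def[abs_def] finite_steps_def
  by (intro borel_measurable_sum borel_measurable_times_ennreal borel_measurable_indicator) auto

text \<open>The steps are the level sets of the nonzero values. Each lies in the support and so has
  finite measure.\<close>

lemma simple_function_disjoint_representation: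
  fixes F :: "'b \<Rightarrow> ennreal"
  assumes F: "simple_function \<mu> F" "\<And>x. F x < \<top>"
    and supp: "emeasure \<mu> {x\<in>space \<mu>. F x \<noteq> 0} < \<infinity>"
  shows "\<exists>n c B. finite_steps \<mu> n c B \<and> (\<forall>x\<in>space \<mu>. F x = step_fun n c B x)"
proof -
  define S where "S = F ` space \<mu> - {0}"
  have S: "finite S" using F by (auto simp: S_def simple_function_def)
  obtain y where y: "bij_betw y {..<card S} S"
    using ex_bij_betw_nat_finite[OF S] by (auto simp: lessThan_atLeast0)
  define c where "c i = enn2real (y i)" for i
  define B where "B i = F -` {y i} \<inter> space \<mu>" for i
  have yS: "y i \<in> S" if "i < card S" for i
    using y that by (auto simp: bij_betw_def)
  have yc: "ennreal (c i) = y i" if "i < card S" for i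
    using yS[OF that] F(2) by (auto simp: S_def c_def)
  have "finite_steps \<mu> (card S) c B"
    unfolding finite_steps_def
  proof (intro conjI allI impI)
    show "0 \<le> c i" for i by (simp add: c_def)
    show "B i \<in> sets \<mu>" if "i < card S" for i
      using F(1) yS[OF that] by (auto simp: B_def simple_function_def S_def)
    show "emeasure \<mu> (B i) < \<infinity>" if "i < card S" for i
    proof -
      have "emeasure \<mu> (B i) \<le> emeasure \<mu> {x\<in>space \<mu>. F x \<noteq> 0}"
      proof (rule emeasure_mono)
        show "B i \<subseteq> {x\<in>space \<mu>. F x \<noteq> 0}" using yS[OF that] by (auto simp: B_def S_def)
        have "F \<in> borel_measurable \<mu>" using F(1) by (rule borel_measurable_simple_function)
        thus "{x\<in>space \<mu>. F x \<noteq> 0} \<in> sets \<mu>" by measurable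
      qed
      thus ?thesis using supp by (rule order.strict_trans1)
    qed
    show "disjoint_family_on B {..<card S}"
      using y by (auto simp: disjoint_family_on_def B_def bij_betw_def inj_on_def)
  qed
  moreover have "F x = step_fun (card S) c B x" if x: "x \<in> space \<mu>" for x
    proof -
      have "(\<Sum>i<card S. ennreal (c i) * indicator (B i) x) = (\<Sum>i<card S. y i * indicator {F x} (y i))"
        using x by (intro sum.cong) (auto simp: yc B_def split: split_indicator)
      also have "\<dots> = (\<Sum>s\<in>S. s * indicator {F x} s)"
        by (rule sum.reindex_bij_betw[OF y])
      also have "\<dots> = (\<Sum>s\<in>S. if s = F x then s else 0)"
        by (intro sum.cong) (auto split: split_indicator)
      also have "\<dots> = F x"
        using S x by (auto simp: sum.delta S_def)
      finally show ?thesis by (simp add: step_fun_def)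
    qed
  ultimately show ?thesis by blast
qed

text \<open>Simple functions increasing to \<open>f\<close> are cut off to an exhausting sequence of
  sets of finite measure. At each point the cutoff is eventually inactive, so convergence survives
  everywhere.\<close>

lemma (in sigma_finite_measure) step_approximation:
  fixes f :: "'a \<Rightarrow> ennreal"
  assumes f: "f \<in> borel_measurable M"
  shows "\<exists>n c B. step_approx M n c B f"
proof -
  obtain g where g: "\<And>i. simple_function M (g i)" "incseq g" "\<And>i x. g i x < \<top>"
      "\<And>x. (SUP i. g i x) = f x"
    using borel_measurable_implies_simple_function_sequence'[OF f] by blast
  obtain A :: "nat \<Rightarrow> 'a set" where A: "range A \<subseteq> sets M" "(\<Union>i. A i) = space M"
      "\<And>i. emeasure M (A i) \<noteq> \<infinity>" "incseq A"
    using sigma_finite_incseq by blast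
  define F where "F m x = g m x * indicator (A m) x" for m x
  have Am: "A m \<in> sets M" for m using A by auto
  have "\<exists>n c B. finite_steps M n c B \<and> (\<forall>x\<in>space M. F m x = step_fun n c B x)" for m
  proof (rule simple_function_disjoint_representation)
    show "simple_function M (F m)"
      unfolding F_def[abs_def] using g(1) Am
      by (intro simple_function_mult simple_function_indicator)
    show "F m x < \<top>" for x
      using g(3)[of m x] by (auto simp: F_def split: split_indicator)
    have "emeasure M {x\<in>space M. F m x \<noteq> 0} \<le> emeasure M (A m)"
      by (intro emeasure_mono Am) (auto simp: F_def split: split_indicator_asm)
    also have "\<dots> < \<infinity>" using A(3)[of m] by (simp add: less_top)
    finally show "emeasure M {x\<in>space M. F m x \<noteq> 0} < \<infinity>" .
  qed
  then obtain n c B where step: "\<And>m. finite_steps M (n m) (c m) (B m)"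
      "\<And>m x. x \<in> space M \<Longrightarrow> F m x = step_fun (n m) (c m) (B m) x"
    by metis
  have "step_approx M n c B f"
    unfolding step_approx_def
  proof (intro conjI allI ballI)
    show "finite_steps M (n m) (c m) (B m)" for m by (rule step)
  next
    fix m x assume x: "x \<in> space M"
    have "g m x \<le> g (Suc m) x" using g(2) by (simp add: incseq_SucD le_funD)
    moreover have "A m \<subseteq> A (Suc m)" using A(4) by (rule incseq_SucD)
    ultimately have "F m x \<le> F (Suc m) x"
      unfolding F_def by (intro mult_mono) (auto split: split_indicator)
    thus "step_fun (n m) (c m) (B m) x \<le> step_fun (n (Suc m)) (c (Suc m)) (B (Suc m)) x"
      using x by (simp add: step)
  next
    fix x assume x: "x \<in> space M"
    obtain k where k: "x \<in> A k" using A(2) x by blast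
    have "(\<lambda>m. g m x) \<longlonglongrightarrow> f x"
      unfolding g(4)[symmetric]
      by (rule LIMSEQ_SUP) (use g(2) in \<open>auto simp: incseq_def le_fun_def\<close>)
    moreover have "\<forall>\<^sub>F m in sequentially. g m x = step_fun (n m) (c m) (B m) x"
      using eventually_ge_at_top[of k]
    proof eventually_elim
      case (elim m)
      have "x \<in> A m" using incseqD[OF A(4) elim] k by blast
      thus ?case using step(2)[OF x, of m] by (simp add: F_def)
    qed
    ultimately show "(\<lambda>m. step_fun (n m) (c m) (B m) x) \<longlonglongrightarrow> f x"
      by (rule Lim_transform_eventually)
  qed
  thus ?thesis by blast
qed

section \<open>Sums over a set of points as integrals against the counting measure\<close>

lemma nn_integral_count_space_LIMSEQ:
  fixes F :: "nat \<Rightarrow> 'b \<Rightarrow> ennreal"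
  assumes mono: "\<And>m x. x \<in> A \<Longrightarrow> F m x \<le> F (Suc m) x"
    and lim: "\<And>x. x \<in> A \<Longrightarrow> (\<lambda>m. F m x) \<longlonglongrightarrow> f x"
  shows "(\<lambda>m. \<integral>\<^sup>+x. F m x \<partial>count_space A) \<longlonglongrightarrow> (\<integral>\<^sup>+x. f x \<partial>count_space A)"
proof -
  have "(\<lambda>m. \<integral>\<^sup>+x. F m x * indicator A x \<partial>count_space A) \<longlonglongrightarrow> (\<integral>\<^sup>+x. f x * indicator A x \<partial>count_space A)"
  proof (rule nn_integral_LIMSEQ)
    show "incseq (\<lambda>m x. F m x * indicator A x)"
      using mono by (intro incseq_SucI le_funI) (auto split: split_indicator)
    show "(\<lambda>m. F m x * indicator A x) \<longlonglongrightarrow> f x * indicator A x" for x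
      using lim[of x] by (cases "x \<in> A") auto
  qed auto
  moreover have "(\<integral>\<^sup>+x. h x * indicator A x \<partial>count_space A) = (\<integral>\<^sup>+x. h x \<partial>count_space A)" for h :: "'b \<Rightarrow> ennreal"
    by (intro nn_integral_cong) simp
  ultimately show ?thesis by simp
qed

lemma emeasure_count_space_Int:
  "emeasure (count_space A) (A \<inter> B) = (if finite (A \<inter> B) then ennreal (real (card (A \<inter> B))) else \<top>)"
  by (simp add: emeasure_count_space ennreal_of_nat_eq_real_of_nat)

lemma nn_integral_count_space_indicator_set:
  "(\<integral>\<^sup>+p. indicator B p \<partial>count_space A) = emeasure (count_space A) (A \<inter> B)"
proof -
  have "(\<integral>\<^sup>+p. indicator B p \<partial>count_space A) = (\<integral>\<^sup>+p. indicator (A \<inter> B) p \<partial>count_space A)"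
    by (intro nn_integral_cong) (auto split: split_indicator)
  thus ?thesis by simp
qed

text \<open>For real functions summability and integrability coincide, and both sides default to 0
  when they fail, so the equation is unconditional.\<close>

lemma infsum_eq_lebesgue_integral_count_space:
  fixes f :: "'b \<Rightarrow> real"
  shows "infsum f A = (\<integral>p. f p \<partial>count_space A)"
proof (cases "integrable (count_space A) f")
  case True
  hence "Infinite_Set_Sum.abs_summable_on f A" by (simp add: abs_summable_on_def)
  from infsetsum_infsum[OF this] show ?thesis by (simp add: infsetsum_def)
next
  case False
  hence "\<not> Infinite_Set_Sum.abs_summable_on f A"
    by (simp add: abs_summable_on_def)
  hence "\<not> Infinite_Sum.abs_summable_on f A"
    using abs_summable_equivalent by blast
  hence "\<not> f summable_on A" using summable_on_iff_abs_summable_on_real by blast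
  thus ?thesis using False by (simp add: infsum_not_exists not_integrable_integral_eq)
qed

section \<open>Point sums over a Poisson process: measurability and Laplace functional\<close>

locale poisson_process = sigma_finite_measure \<mu> for \<mu> :: "'b measure" +
  fixes M :: "'a measure" and \<Psi> :: "'a \<Rightarrow> 'b set"
  assumes ppp: "poisson_pp M \<mu> \<Psi>"
begin

sublocale P: prob_space M
  using ppp unfolding poisson_pp_def by (rule conjunct1)

lemma points_in_space: "\<omega> \<in> space M \<Longrightarrow> \<Psi> \<omega> \<subseteq> space \<mu>"
  using ppp[unfolded poisson_pp_def, THEN conjunct2, THEN conjunct1] by (rule bspec)

lemma count_sets:
  assumes "B \<in> sets \<mu>" "emeasure \<mu> B < \<infinity>"
  shows "{\<omega>\<in>space M. finite (\<Psi> \<omega> \<inter> B) \<and> card (\<Psi> \<omega> \<inter> B) = k} \<in> sets M"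
  using ppp[unfolded poisson_pp_def, THEN conjunct2, THEN conjunct2, THEN conjunct1, rule_format, OF assms]
  by (rule conjunct1)

lemma count_prob:
  assumes "B \<in> sets \<mu>" "emeasure \<mu> B < \<infinity>"
  shows "measure M {\<omega>\<in>space M. finite (\<Psi> \<omega> \<inter> B) \<and> card (\<Psi> \<omega> \<inter> B) = k}
    = measure \<mu> B ^ k / fact k * exp (- measure \<mu> B)"
  using ppp[unfolded poisson_pp_def, THEN conjunct2, THEN conjunct2, THEN conjunct1, rule_format, OF assms]
  by (rule conjunct2)

lemma count_indep:
  fixes n :: nat and B :: "nat \<Rightarrow> 'b set"
  assumes "\<And>i. i < n \<Longrightarrow> B i \<in> sets \<mu>" "\<And>i. i < n \<Longrightarrow> emeasure \<mu> (B i) < \<infinity>"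
    and "disjoint_family_on B {..<n}"
  shows "P.indep_vars (\<lambda>_. count_space UNIV) (\<lambda>i \<omega>. card (\<Psi> \<omega> \<inter> B i)) {..<n}"
  using ppp[unfolded poisson_pp_def, THEN conjunct2, THEN conjunct2, THEN conjunct2, rule_format, of n B] assms
  by simp

lemma finite_points_sets:
  assumes "B \<in> sets \<mu>" "emeasure \<mu> B < \<infinity>"
  shows "{\<omega>\<in>space M. finite (\<Psi> \<omega> \<inter> B)} \<in> sets M"
proof -
  have "{\<omega>\<in>space M. finite (\<Psi> \<omega> \<inter> B)} =
      (\<Union>k. {\<omega>\<in>space M. finite (\<Psi> \<omega> \<inter> B) \<and> card (\<Psi> \<omega> \<inter> B) = k})" by auto
  also have "\<dots> \<in> sets M" using count_sets[OF assms] by blast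
  finally show ?thesis .
qed

text \<open>\<open>count_sets\<close> treats a count only jointly with finiteness, whereas the bare
  \<open>card\<close> is 0 on infinite sets too. Its measurability is contained in
  \<open>indep_vars\<close>, applied to a family of one set.\<close>

lemma measurable_card:
  assumes "B \<in> sets \<mu>" "emeasure \<mu> B < \<infinity>"
  shows "(\<lambda>\<omega>. card (\<Psi> \<omega> \<inter> B)) \<in> measurable M (count_space UNIV)"
  using count_indep[of 1 "\<lambda>_. B"] assms
  by (auto simp: P.indep_vars_def disjoint_family_on_def)

lemma measurable_emeasure_count_finite:
  assumes "B \<in> sets \<mu>" "emeasure \<mu> B < \<infinity>"
  shows "(\<lambda>\<omega>. emeasure (count_space (\<Psi> \<omega>)) (\<Psi> \<omega> \<inter> B)) \<in> borel_measurable M"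
proof -
  have [measurable]: "Measurable.pred M (\<lambda>\<omega>. finite (\<Psi> \<omega> \<inter> B))"
    using finite_points_sets[OF assms] by (simp add: pred_def)
  have [measurable]: "(\<lambda>\<omega>. card (\<Psi> \<omega> \<inter> B)) \<in> measurable M (count_space UNIV)"
    by (rule measurable_card[OF assms])
  show ?thesis unfolding emeasure_count_space_Int by measurable
qed

lemma nn_integral_points_step_fun:
  assumes "finite_steps \<mu> n c B"
  shows "(\<integral>\<^sup>+p. step_fun n c B p \<partial>count_space (\<Psi> \<omega>)) =
    (\<Sum>i<n. ennreal (c i) * emeasure (count_space (\<Psi> \<omega>)) (\<Psi> \<omega> \<inter> B i))"
proof -
  have "(\<integral>\<^sup>+p. step_fun n c B p \<partial>count_space (\<Psi> \<omega>)) =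
      (\<Sum>i<n. \<integral>\<^sup>+p. ennreal (c i) * indicator (B i) p \<partial>count_space (\<Psi> \<omega>))"
    unfolding step_fun_def by (rule nn_integral_sum) simp
  also have "\<dots> = (\<Sum>i<n. ennreal (c i) * emeasure (count_space (\<Psi> \<omega>)) (\<Psi> \<omega> \<inter> B i))"
    by (intro sum.cong refl) (subst nn_integral_cmult, auto simp only: nn_integral_count_space_indicator_set borel_measurable_count_space)
  finally show ?thesis .
qed

lemma nn_integral_points_LIMSEQ:
  assumes "\<And>m x. x \<in> space \<mu> \<Longrightarrow> F m x \<le> F (Suc m) x"
    and "\<And>x. x \<in> space \<mu> \<Longrightarrow> (\<lambda>m. F m x) \<longlonglongrightarrow> f x" and "\<omega> \<in> space M"
  shows "(\<lambda>m. \<integral>\<^sup>+p. F m p \<partial>count_space (\<Psi> \<omega>)) \<longlonglongrightarrow> (\<integral>\<^sup>+p. f p \<partial>count_space (\<Psi> \<omega>))"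
proof (rule nn_integral_count_space_LIMSEQ)
  fix x assume "x \<in> \<Psi> \<omega>"
  hence x: "x \<in> space \<mu>" using points_in_space[OF assms(3)] by blast
  show "F m x \<le> F (Suc m) x" for m by (rule assms(1)[OF x])
  show "(\<lambda>m. F m x) \<longlonglongrightarrow> f x" by (rule assms(2)[OF x])
qed

text \<open>For a step function the point sum is a finite combination of counts; the general case is
  a pointwise limit of these.\<close>

lemma measurable_nn_integral_points:
  assumes "f \<in> borel_measurable \<mu>"
  shows "(\<lambda>\<omega>. \<integral>\<^sup>+p. f p \<partial>count_space (\<Psi> \<omega>)) \<in> borel_measurable M"
proof -
  obtain n c B where "step_approx \<mu> n c B f"
    using step_approximation[OF assms] by blast
  note s = step_approxD[OF this]
  show ?thesis
  proof (rule borel_measurable_LIMSEQ_order)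
    show "(\<lambda>m. \<integral>\<^sup>+p. step_fun (n m) (c m) (B m) p \<partial>count_space (\<Psi> \<omega>))
        \<longlonglongrightarrow> (\<integral>\<^sup>+p. f p \<partial>count_space (\<Psi> \<omega>))" if "\<omega> \<in> space M" for \<omega>
      by (rule nn_integral_points_LIMSEQ) (use s(2,3) that in auto)
    show "(\<lambda>\<omega>. \<integral>\<^sup>+p. step_fun (n m) (c m) (B m) p \<partial>count_space (\<Psi> \<omega>)) \<in> borel_measurable M" for m
      unfolding nn_integral_points_step_fun[OF s(1)]
      using measurable_emeasure_count_finite s(1)[of m]
      by (intro borel_measurable_sum borel_measurable_times_ennreal) (auto simp: finite_steps_def)
  qed
qed

lemma measurable_exp_neg_points:
  assumes "f \<in> borel_measurable \<mu>"
  shows "(\<lambda>\<omega>. exp_neg (\<integral>\<^sup>+p. f p \<partial>count_space (\<Psi> \<omega>))) \<in> borel_measurable M"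
  by (rule measurable_compose[OF measurable_nn_integral_points[OF assms] measurable_exp_neg])

text \<open>\<open>poisson_pp\<close> does not state local finiteness outright; it follows because
  the Poisson probabilities of the finite counts add up to 1.\<close>

lemma AE_finite_points:
  assumes B: "B \<in> sets \<mu>" "emeasure \<mu> B < \<infinity>"
  shows "AE \<omega> in M. finite (\<Psi> \<omega> \<inter> B)"
proof -
  let ?m = "measure \<mu> B"
  let ?E = "\<lambda>k. {\<omega>\<in>space M. finite (\<Psi> \<omega> \<inter> B) \<and> card (\<Psi> \<omega> \<inter> B) = k}"
  have "(\<lambda>k. P.prob (?E k)) sums P.prob (\<Union>k. ?E k)"
    by (rule P.finite_measure_UNION) (use count_sets[OF B] in \<open>auto simp: disjoint_family_on_def\<close>)
  moreover have "(\<lambda>k. ?m ^ k /\<^sub>R fact k * exp (- ?m)) sums (exp ?m * exp (- ?m))"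
    by (intro sums_mult2 exp_converges)
  hence "(\<lambda>k. P.prob (?E k)) sums 1"
    by (simp add: count_prob[OF B] exp_minus field_simps)
  ultimately have "P.prob (\<Union>k. ?E k) = 1" by (rule sums_unique2)
  hence "AE \<omega> in M. \<omega> \<in> (\<Union>k. ?E k)"
    by (rule P.AE_prob_1)
  thus ?thesis by eventually_elim auto
qed

text \<open>For mass 0 the Poisson law gives the count 0 the probability
  \<open>0 ^ 0 / fact 0 * exp 0 = 1\<close>.\<close>

lemma AE_no_points:
  assumes "B \<in> sets \<mu>" "emeasure \<mu> B = 0"
  shows "AE \<omega> in M. \<Psi> \<omega> \<inter> B = {}"
proof -
  have "P.prob {\<omega>\<in>space M. finite (\<Psi> \<omega> \<inter> B) \<and> card (\<Psi> \<omega> \<inter> B) = 0} = 1"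
    by (subst count_prob) (use assms in \<open>auto simp: measure_def\<close>)
  hence "AE \<omega> in M. \<omega> \<in> {\<omega>\<in>space M. finite (\<Psi> \<omega> \<inter> B) \<and> card (\<Psi> \<omega> \<inter> B) = 0}"
    by (rule P.AE_prob_1)
  thus ?thesis by eventually_elim auto
qed

text \<open>This is the Poisson generating function at \<open>exp (- c)\<close>: the sum over
  \<open>k\<close> is the exponential series of \<open>measure \<mu> B * exp (- c)\<close>, times
  \<open>exp (- measure \<mu> B)\<close>.\<close>

lemma expectation_exp_card:
  assumes B: "B \<in> sets \<mu>" "emeasure \<mu> B < \<infinity>" and c: "0 \<le> c"
  shows "P.expectation (\<lambda>\<omega>. exp (- (c * real (card (\<Psi> \<omega> \<inter> B)))))
    = exp (- (measure \<mu> B * (1 - exp (- c))))"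
proof -
  let ?m = "measure \<mu> B"
  let ?E = "\<lambda>k. {\<omega>\<in>space M. finite (\<Psi> \<omega> \<inter> B) \<and> card (\<Psi> \<omega> \<inter> B) = k}"
  note [measurable] = measurable_card[OF B] count_sets[OF B]
  \<comment> \<open>The events \<open>?E k\<close> include finiteness, so they capture
    \<open>\<omega>\<close> only if its count is finite; the expansion holds almost
    everywhere.\<close>
  have "(\<integral>\<^sup>+\<omega>. ennreal (exp (- (c * real (card (\<Psi> \<omega> \<inter> B))))) \<partial>M)
      = (\<integral>\<^sup>+\<omega>. (\<Sum>k. ennreal (exp (- c) ^ k) * indicator (?E k) \<omega>) \<partial>M)"
  proof (rule nn_integral_cong_AE)
    show "AE \<omega> in M. ennreal (exp (- (c * real (card (\<Psi> \<omega> \<inter> B)))))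
        = (\<Sum>k. ennreal (exp (- c) ^ k) * indicator (?E k) \<omega>)"
      using AE_finite_points[OF B] AE_space
    proof eventually_elim
      case (elim \<omega>)
      have "(\<Sum>k. ennreal (exp (- c) ^ k) * indicator (?E k) \<omega>)
          = (\<Sum>k\<in>{card (\<Psi> \<omega> \<inter> B)}. ennreal (exp (- c) ^ k) * indicator (?E k) \<omega>)"
        by (rule suminf_finite) auto
      also have "\<dots> = ennreal (exp (- (c * real (card (\<Psi> \<omega> \<inter> B)))))"
        using elim by (simp flip: exp_of_nat_mult add: mult.commute)
      finally show ?case ..
    qed
  qed
  also have "\<dots> = (\<Sum>k. \<integral>\<^sup>+\<omega>. ennreal (exp (- c) ^ k) * indicator (?E k) \<omega> \<partial>M)"
    by (rule nn_integral_suminf) simp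
  also have "\<dots> = (\<Sum>k. ennreal (exp (- c) ^ k * (?m ^ k / fact k * exp (- ?m))))"
    by (intro suminf_cong)
      (simp add: nn_integral_cmult_indicator P.emeasure_eq_measure count_prob[OF B] flip: ennreal_mult)
  also have "\<dots> = ennreal (exp (?m * exp (- c)) * exp (- ?m))"
  proof (rule suminf_ennreal_eq)
    have "(\<lambda>k. (?m * exp (- c)) ^ k /\<^sub>R fact k * exp (- ?m)) sums (exp (?m * exp (- c)) * exp (- ?m))"
      by (intro sums_mult2 exp_converges)
    thus "(\<lambda>k. exp (- c) ^ k * (?m ^ k / fact k * exp (- ?m))) sums (exp (?m * exp (- c)) * exp (- ?m))"
      by (simp add: field_simps power_mult_distrib)
  qed auto
  also have "exp (?m * exp (- c)) * exp (- ?m) = exp (- (?m * (1 - exp (- c))))"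
    by (simp flip: exp_add add: algebra_simps)
  finally show ?thesis
    by (subst integral_eq_nn_integral) auto
qed

text \<open>The point sum of a step function is a linear combination of counts of disjoint sets.
  These counts are independent, so the expectation of the product of exponentials factors.\<close>

lemma expectation_exp_neg_step_fun:
  assumes s: "finite_steps \<mu> n c B"
  shows "P.expectation (\<lambda>\<omega>. exp_neg (\<integral>\<^sup>+p. step_fun n c B p \<partial>count_space (\<Psi> \<omega>)))
    = exp (- (\<Sum>i<n. measure \<mu> (B i) * (1 - exp (- c i))))"
proof -
  have c: "0 \<le> c i" and B: "B i \<in> sets \<mu>" "emeasure \<mu> (B i) < \<infinity>" if "i < n" for i
    using s that by (auto simp: finite_steps_def)
  have "AE \<omega> in M. \<forall>i<n. finite (\<Psi> \<omega> \<inter> B i)"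
    using AE_finite_points[OF B] by (subst AE_all_countable) auto
  hence "AE \<omega> in M. exp_neg (\<integral>\<^sup>+p. step_fun n c B p \<partial>count_space (\<Psi> \<omega>))
      = (\<Prod>i<n. exp (- (c i * real (card (\<Psi> \<omega> \<inter> B i)))))"
  proof eventually_elim
    case (elim \<omega>)
    have "(\<integral>\<^sup>+p. step_fun n c B p \<partial>count_space (\<Psi> \<omega>))
        = (\<Sum>i<n. ennreal (c i * real (card (\<Psi> \<omega> \<inter> B i))))"
      unfolding nn_integral_points_step_fun[OF s]
      using elim c by (intro sum.cong) (auto simp: emeasure_count_space_Int ennreal_mult)
    also have "\<dots> = ennreal (\<Sum>i<n. c i * real (card (\<Psi> \<omega> \<inter> B i)))"
      using c by (intro sum_ennreal) auto
    finally have "exp_neg (\<integral>\<^sup>+p. step_fun n c B p \<partial>count_space (\<Psi> \<omega>))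
        = exp (- (\<Sum>i<n. c i * real (card (\<Psi> \<omega> \<inter> B i))))"
      using c by (auto intro!: exp_neg_ennreal sum_nonneg mult_nonneg_nonneg)
    also have "\<dots> = (\<Prod>i<n. exp (- (c i * real (card (\<Psi> \<omega> \<inter> B i)))))"
      unfolding sum_negf[symmetric] by (rule exp_sum) simp
    finally show ?case .
  qed
  hence "P.expectation (\<lambda>\<omega>. exp_neg (\<integral>\<^sup>+p. step_fun n c B p \<partial>count_space (\<Psi> \<omega>)))
      = P.expectation (\<lambda>\<omega>. \<Prod>i<n. exp (- (c i * real (card (\<Psi> \<omega> \<inter> B i)))))"
  proof (rule integral_cong_AE[rotated 2])
    show "(\<lambda>\<omega>. exp_neg (\<integral>\<^sup>+p. step_fun n c B p \<partial>count_space (\<Psi> \<omega>))) \<in> borel_measurable M"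
      by (rule measurable_exp_neg_points[OF measurable_step_fun[OF s]])
    show "(\<lambda>\<omega>. \<Prod>i<n. exp (- (c i * real (card (\<Psi> \<omega> \<inter> B i))))) \<in> borel_measurable M"
      using measurable_card[OF B] by (intro borel_measurable_prod) (auto intro: measurable_compose)
  qed
  also have "\<dots> = (\<Prod>i<n. P.expectation (\<lambda>\<omega>. exp (- (c i * real (card (\<Psi> \<omega> \<inter> B i))))))"
  proof (rule P.indep_vars_lebesgue_integral)
    show "P.indep_vars (\<lambda>_. borel) (\<lambda>i \<omega>. exp (- (c i * real (card (\<Psi> \<omega> \<inter> B i))))) {..<n}"
      by (rule P.indep_vars_compose2[where Y = "\<lambda>i k. exp (- (c i * real k))"])
        (use s in \<open>auto intro!: count_indep simp: finite_steps_def\<close>)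
    show "integrable M (\<lambda>\<omega>. exp (- (c i * real (card (\<Psi> \<omega> \<inter> B i)))))" if "i \<in> {..<n}" for i
      using measurable_card[OF B] c that
      by (intro P.integrable_const_bound[where B = 1]) auto
  qed simp
  also have "\<dots> = (\<Prod>i<n. exp (- (measure \<mu> (B i) * (1 - exp (- c i)))))"
    using B c by (intro prod.cong refl expectation_exp_card) auto
  also have "\<dots> = exp (- (\<Sum>i<n. measure \<mu> (B i) * (1 - exp (- c i))))"
    unfolding sum_negf[symmetric] by (rule exp_sum[symmetric]) simp
  finally show ?thesis .
qed

text \<open>By disjointness at most one step is active at \<open>x\<close>, so
  \<open>1 - exp_neg\<close> acts on each coefficient separately. Up to sign, the value is the
  exponent in the preceding expectation.\<close>

lemma nn_integral_one_minus_exp_neg_step_fun: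
  assumes s: "finite_steps \<mu> n c B"
  shows "(\<integral>\<^sup>+x. ennreal (1 - exp_neg (step_fun n c B x)) \<partial>\<mu>)
    = ennreal (\<Sum>i<n. measure \<mu> (B i) * (1 - exp (- c i)))"
proof -
  have c: "0 \<le> c i" and B: "B i \<in> sets \<mu>" "emeasure \<mu> (B i) < \<infinity>" if "i < n" for i
    using s that by (auto simp: finite_steps_def)
  have "ennreal (1 - exp_neg (step_fun n c B x)) = (\<Sum>i<n. ennreal (1 - exp (- c i)) * indicator (B i) x)" for x
  proof (cases "\<exists>j<n. x \<in> B j")
    case True
    then obtain j where j: "j < n" "x \<in> B j" by blast
    have ind: "indicator (B i) x = (if i = j then 1 else 0 :: ennreal)" if "i < n" for i
      using s j that by (auto simp: finite_steps_def disjoint_family_on_def split: split_indicator)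
    have "(\<Sum>i<n. a i * indicator (B i) x) = a j" for a :: "nat \<Rightarrow> ennreal"
    proof -
      have "(\<Sum>i<n. a i * indicator (B i) x) = (\<Sum>i<n. if i = j then a i else 0)"
        using ind by (intro sum.cong) auto
      thus ?thesis using j by simp
    qed
    thus ?thesis using c j by (simp add: step_fun_def exp_neg_ennreal)
  next
    case False
    thus ?thesis by (auto simp: step_fun_def indicator_def intro!: sum.neutral)
  qed
  hence "(\<integral>\<^sup>+x. ennreal (1 - exp_neg (step_fun n c B x)) \<partial>\<mu>)
      = (\<integral>\<^sup>+x. (\<Sum>i<n. ennreal (1 - exp (- c i)) * indicator (B i) x) \<partial>\<mu>)"
    by (simp only:)
  also have "\<dots> = (\<Sum>i<n. \<integral>\<^sup>+x. ennreal (1 - exp (- c i)) * indicator (B i) x \<partial>\<mu>)"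
    using B by (intro nn_integral_sum) auto
  also have "\<dots> = (\<Sum>i<n. ennreal (1 - exp (- c i)) * emeasure \<mu> (B i))"
    using B by (intro sum.cong refl nn_integral_cmult_indicator) auto
  also have "\<dots> = (\<Sum>i<n. ennreal (measure \<mu> (B i) * (1 - exp (- c i))))"
  proof (intro sum.cong refl)
    fix i assume "i \<in> {..<n}"
    hence "emeasure \<mu> (B i) = ennreal (measure \<mu> (B i))" "0 \<le> c i"
      using B[of i] c[of i] by (auto simp: emeasure_eq_ennreal_measure)
    thus "ennreal (1 - exp (- c i)) * emeasure \<mu> (B i) = ennreal (measure \<mu> (B i) * (1 - exp (- c i)))"
      by (simp add: ennreal_mult mult.commute)
  qed
  also have "\<dots> = ennreal (\<Sum>i<n. measure \<mu> (B i) * (1 - exp (- c i)))"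
    using c by (intro sum_ennreal) auto
  finally show ?thesis .
qed

text \<open>Both sides pass to the limit along \<open>step_approx\<close>: the exponents by monotone
  convergence, the expectations by dominated convergence with bound 1.\<close>

theorem laplace_functional:
  assumes f: "f \<in> borel_measurable \<mu>"
    and v: "(\<integral>\<^sup>+x. ennreal (1 - exp_neg (f x)) \<partial>\<mu>) = ennreal v" "0 \<le> v"
  shows "P.expectation (\<lambda>\<omega>. exp_neg (\<integral>\<^sup>+p. f p \<partial>count_space (\<Psi> \<omega>))) = exp (- v)"
proof -
  obtain n c B where "step_approx \<mu> n c B f"
    using step_approximation[OF f] by blast
  note s = step_approxD[OF this]
  define F where "F m = step_fun (n m) (c m) (B m)" for m
  note s = s[folded F_def]
  define v' where "v' m = (\<Sum>i<n m. measure \<mu> (B m i) * (1 - exp (- c m i)))" for m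
  have [measurable]: "F m \<in> borel_measurable \<mu>" for m
    unfolding F_def by (rule measurable_step_fun[OF s(1)[unfolded F_def]])
  have "(\<lambda>m. \<integral>\<^sup>+x. ennreal (1 - exp_neg (F m x)) \<partial>\<mu>) \<longlonglongrightarrow> (\<integral>\<^sup>+x. ennreal (1 - exp_neg (f x)) \<partial>\<mu>)"
  proof -
    have lim: "(\<lambda>m. ennreal (1 - exp_neg (F m x))) \<longlonglongrightarrow> ennreal (1 - exp_neg (f x))" if "x \<in> space \<mu>" for x
      using s(3)[OF that] by (intro tendsto_intros tendsto_exp_neg)
    have mono: "ennreal (1 - exp_neg (F m x)) \<le> ennreal (1 - exp_neg (F (Suc m) x))" if "x \<in> space \<mu>" for m x
      using exp_neg_antimono[OF s(2)[OF that, of m]] by (intro ennreal_leI) simp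
    have "(\<lambda>m. \<integral>\<^sup>+x. ennreal (1 - exp_neg (F m x)) * indicator (space \<mu>) x \<partial>\<mu>)
        \<longlonglongrightarrow> (\<integral>\<^sup>+x. ennreal (1 - exp_neg (f x)) * indicator (space \<mu>) x \<partial>\<mu>)"
    proof (rule nn_integral_LIMSEQ)
      show "incseq (\<lambda>m x. ennreal (1 - exp_neg (F m x)) * indicator (space \<mu>) x)"
        using mono by (intro incseq_SucI le_funI) (auto split: split_indicator)
      show "(\<lambda>m. ennreal (1 - exp_neg (F m x)) * indicator (space \<mu>) x)
          \<longlonglongrightarrow> ennreal (1 - exp_neg (f x)) * indicator (space \<mu>) x" for x
        using lim[of x] by (cases "x \<in> space \<mu>") auto
    qed measurable
    thus ?thesis by (simp cong: nn_integral_cong)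
  qed
  hence "(\<lambda>m. ennreal (v' m)) \<longlonglongrightarrow> ennreal v"
    unfolding F_def nn_integral_one_minus_exp_neg_step_fun[OF s(1)] v v'_def .
  moreover have "0 \<le> v' m" for m
    using s(1)[of m] by (auto simp: v'_def finite_steps_def intro!: sum_nonneg)
  ultimately have "v' \<longlonglongrightarrow> v" using v(2) by (simp add: tendsto_ennreal_iff)
  hence "(\<lambda>m. exp (- v' m)) \<longlonglongrightarrow> exp (- v)" by (intro tendsto_intros)
  moreover have "(\<lambda>m. P.expectation (\<lambda>\<omega>. exp_neg (\<integral>\<^sup>+p. F m p \<partial>count_space (\<Psi> \<omega>))))
      \<longlonglongrightarrow> P.expectation (\<lambda>\<omega>. exp_neg (\<integral>\<^sup>+p. f p \<partial>count_space (\<Psi> \<omega>)))"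
  proof (rule integral_dominated_convergence[where w = "\<lambda>_. 1"])
    show "(\<lambda>\<omega>. exp_neg (\<integral>\<^sup>+p. f p \<partial>count_space (\<Psi> \<omega>))) \<in> borel_measurable M"
      by (rule measurable_exp_neg_points[OF f])
    show "(\<lambda>\<omega>. exp_neg (\<integral>\<^sup>+p. F m p \<partial>count_space (\<Psi> \<omega>))) \<in> borel_measurable M" for m
      by (rule measurable_exp_neg_points) simp
    show "AE \<omega> in M. (\<lambda>m. exp_neg (\<integral>\<^sup>+p. F m p \<partial>count_space (\<Psi> \<omega>)))
        \<longlonglongrightarrow> exp_neg (\<integral>\<^sup>+p. f p \<partial>count_space (\<Psi> \<omega>))"
      by (intro AE_I2 tendsto_exp_neg nn_integral_points_LIMSEQ) (use s in auto)
  qed auto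
  ultimately show ?thesis
    unfolding F_def expectation_exp_neg_step_fun[OF s(1)[unfolded F_def]] v'_def
    by (rule LIMSEQ_unique[rotated])
qed

text \<open>The counts in \<^const>\<open>pp_counts\<close> are values of \<^const>\<open>card\<close>, hence 0 on infinite sets, so a point
  sum agrees with a function of the counts only almost everywhere.\<close>

lemma nn_integral_points_counts_version:
  assumes f: "f \<in> borel_measurable \<mu>"
  shows "\<exists>X. X \<in> borel_measurable (vimage_algebra (space M) (pp_counts \<mu> \<Psi>) (pp_counts_space \<mu>)) \<and>
    (AE \<omega> in M. X \<omega> = (\<integral>\<^sup>+p. f p \<partial>count_space (\<Psi> \<omega>)))"
proof -
  let ?V = "vimage_algebra (space M) (pp_counts \<mu> \<Psi>) (pp_counts_space \<mu>)"
  obtain n c B where "step_approx \<mu> n c B f"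
    using step_approximation[OF f] by blast
  note s = step_approxD[OF this]
  have B: "B m i \<in> sets \<mu>" "emeasure \<mu> (B m i) < \<infinity>" if "i < n m" for m i
    using s(1)[of m] that by (auto simp: finite_steps_def)
  have count: "(\<lambda>\<omega>. card (\<Psi> \<omega> \<inter> A)) \<in> measurable ?V (count_space UNIV)"
    if A: "A \<in> sets \<mu>" "emeasure \<mu> A < \<infinity>" for A
  proof -
    have "pp_counts \<mu> \<Psi> \<in> measurable ?V (pp_counts_space \<mu>)"
      by (rule measurable_vimage_algebra1) (auto simp: pp_counts_def pp_counts_space_def space_PiM)
    moreover have "(\<lambda>g. g A) \<in> measurable (pp_counts_space \<mu>) (count_space UNIV)"
      unfolding pp_counts_space_def by (rule measurable_component_singleton) (use A in auto)
    ultimately have "(\<lambda>\<omega>. pp_counts \<mu> \<Psi> \<omega> A) \<in> measurable ?V (count_space UNIV)"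
      by (rule measurable_compose)
    thus ?thesis using A by (simp add: pp_counts_def)
  qed
  \<comment> \<open>A supremum of measurable functions is measurable whether or not the sums
    increase; with infinite counts replaced by 0 they may fail to.\<close>
  define X where "X \<omega> = (SUP m. \<Sum>i<n m. ennreal (c m i) * ennreal (real (card (\<Psi> \<omega> \<inter> B m i))))" for \<omega>
  have "X \<in> borel_measurable ?V"
    unfolding X_def[abs_def]
  proof (intro borel_measurable_SUP borel_measurable_sum borel_measurable_times_ennreal)
    fix m i assume "i \<in> {..<n m}"
    hence [measurable]: "(\<lambda>\<omega>. card (\<Psi> \<omega> \<inter> B m i)) \<in> measurable ?V (count_space UNIV)"
      using B by (intro count) auto
    show "(\<lambda>\<omega>. ennreal (real (card (\<Psi> \<omega> \<inter> B m i)))) \<in> borel_measurable ?V"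
      by measurable
  qed auto
  moreover have "AE \<omega> in M. \<forall>m. \<forall>i<n m. finite (\<Psi> \<omega> \<inter> B m i)"
    using AE_finite_points[OF B] by (simp add: AE_all_countable)
  hence "AE \<omega> in M. X \<omega> = (\<integral>\<^sup>+p. f p \<partial>count_space (\<Psi> \<omega>))"
    using AE_space
  proof eventually_elim
    case (elim \<omega>)
    let ?F = "\<lambda>m. \<integral>\<^sup>+p. step_fun (n m) (c m) (B m) p \<partial>count_space (\<Psi> \<omega>)"
    have "(\<Sum>i<n m. ennreal (c m i) * ennreal (real (card (\<Psi> \<omega> \<inter> B m i)))) = ?F m" for m
      unfolding nn_integral_points_step_fun[OF s(1)]
      using elim(1) by (intro sum.cong) (auto simp: emeasure_count_space_Int)
    hence X: "X \<omega> = (SUP m. ?F m)" by (simp add: X_def)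
    have "?F \<longlonglongrightarrow> (SUP m. ?F m)"
      by (intro LIMSEQ_SUP incseq_SucI nn_integral_mono s(2)) (use points_in_space[OF elim(2)] in auto)
    moreover have "?F \<longlonglongrightarrow> (\<integral>\<^sup>+p. f p \<partial>count_space (\<Psi> \<omega>))"
      by (rule nn_integral_points_LIMSEQ) (use s elim in auto)
    ultimately show ?case unfolding X by (rule LIMSEQ_unique)
  qed
  ultimately show ?thesis by blast
qed

end

subsection \<open>Interference and coverage\<close>

text \<open>Polar coordinates for functions of the norm: both measures give \<open>{..a}\<close> the
  area of the disc of radius \<open>a\<close>, and these half-lines are stable under intersection
  and generate the Borel sets.\<close>

lemma distr_norm_lborel_real2:
  "distr (lborel :: (real^2) measure) borel norm
    = density lborel (\<lambda>r. ennreal (2 * pi * r) * indicator {0..} r)" (is "?D = ?E")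
proof (rule measure_eqI_generator_eq[where E = "range (\<lambda>a::real. {..a})" and \<Omega> = UNIV and A = "\<lambda>i. {..real i}"])
  show "Int_stable (range (\<lambda>a::real. {..a}))"
    by (auto simp: Int_stable_def)
  show "sets ?D = sigma_sets UNIV (range (\<lambda>a::real. {..a}))"
    by (simp add: borel_eq_atMost)
  show "sets ?E = sigma_sets UNIV (range (\<lambda>a::real. {..a}))"
    by (simp add: borel_eq_atMost)
  have D: "emeasure ?D {..a} = ennreal (if 0 \<le> a then pi * a\<^sup>2 else 0)" for a
  proof -
    have "emeasure ?D {..a} = emeasure (lborel :: (real^2) measure) {x. norm x \<le> a}"
      by (subst emeasure_distr) (auto simp: vimage_def)
    also have "{x :: real^2. norm x \<le> a} = cball 0 a" by auto
    finally show ?thesis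
      by (cases "0 \<le> a") (auto simp: emeasure_cball unit_ball_vol_2)
  qed
  fix X assume "X \<in> range (\<lambda>a::real. {..a})"
  then obtain a where X: "X = {..a}" by blast
  have "emeasure ?E {..a} = (\<integral>\<^sup>+r. ennreal (2 * pi * r) * indicator {0..a} r \<partial>lborel)"
    by (subst emeasure_density) (auto intro!: nn_integral_cong split: split_indicator)
  also have "\<dots> = ennreal (if 0 \<le> a then pi * a\<^sup>2 else 0)"
  proof (cases "0 \<le> a")
    case True
    have "(\<integral>\<^sup>+r. ennreal (2 * pi * r) * indicator {0..a} r \<partial>lborel) = ennreal (pi * a\<^sup>2 - pi * 0\<^sup>2)"
      by (rule nn_integral_FTC_Icc) (use True in \<open>auto intro!: derivative_eq_intros\<close>)
    thus ?thesis using True by simp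
  qed auto
  finally show "emeasure ?D X = emeasure ?E X" unfolding X D by simp
next
  have D: "emeasure ?D {..real i} = emeasure (lborel :: (real^2) measure) (cball 0 (real i))" for i
    by (subst emeasure_distr) (auto intro!: arg_cong2[where f = emeasure])
  show "emeasure ?D {..real i} \<noteq> \<infinity>" for i
    unfolding D by (simp add: emeasure_cball)
  show "(\<Union>i. {..real i}) = UNIV"
    by (auto intro: real_arch_simple)
qed auto

lemma nn_integral_norm_real2:
  fixes \<phi> :: "real \<Rightarrow> ennreal"
  assumes [measurable]: "\<phi> \<in> borel_measurable borel"
  shows "(\<integral>\<^sup>+x. \<phi> (norm (x :: real^2)) \<partial>lborel)
    = (\<integral>\<^sup>+r. ennreal (2 * pi * r) * indicator {0..} r * \<phi> r \<partial>lborel)"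
proof -
  have "(\<integral>\<^sup>+x. \<phi> (norm (x :: real^2)) \<partial>lborel) = (\<integral>\<^sup>+r. \<phi> r \<partial>distr (lborel :: (real^2) measure) borel norm)"
    by (subst nn_integral_distr) auto
  also have "\<dots> = (\<integral>\<^sup>+r. ennreal (2 * pi * r) * indicator {0..} r * \<phi> r \<partial>lborel)"
    unfolding distr_norm_lborel_real2 by (subst nn_integral_density) auto
  finally show ?thesis .
qed

text \<open>The average over an Exp(1) mark is \<open>1 - 1 / (1 + q)\<close>, one minus the Laplace
  transform. With \<open>q = k r\<close> it is the kernel of the radial integral.\<close>

lemma nn_integral_one_minus_exp_exponential:
  fixes q :: real
  assumes q: "0 \<le> q"
  shows "(\<integral>\<^sup>+h. ennreal (exponential_density 1 h * (1 - exp (- (q * h)))) \<partial>lborel) = ennreal (q / (1 + q))"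
proof -
  define F where "F h = exp (- ((1 + q) * h)) / (1 + q) - exp (- h)" for h
  have "(\<integral>\<^sup>+h. ennreal (exponential_density 1 h * (1 - exp (- (q * h)))) \<partial>lborel)
      = (\<integral>\<^sup>+h. ennreal (exp (- h) * (1 - exp (- (q * h)))) * indicator {0..} h \<partial>lborel)"
    by (intro nn_integral_cong) (auto simp: exponential_density_def split: split_indicator)
  also have "\<dots> = ennreal (0 - F 0)"
  proof (rule nn_integral_FTC_atLeast)
    show "DERIV F h :> exp (- h) * (1 - exp (- (q * h)))" for h
    proof -
      have d: "DERIV F h :> exp (- ((1 + q) * h)) * (- 1 - q) / (1 + q) + exp (- h)"
        unfolding F_def using q by (auto intro!: derivative_eq_intros)
      have e: "exp (- ((1 + q) * h)) = exp (- h) * exp (- (q * h))"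
        by (simp flip: exp_add add: algebra_simps)
      have m: "x * (- 1 - q) / (1 + q) = - x" for x
      proof -
        have "(- 1 - q) / (1 + q) = - 1" using q by (simp add: field_simps)
        thus ?thesis by (simp flip: times_divide_eq_right)
      qed
      show ?thesis using d unfolding m e by (simp add: right_diff_distrib)
    qed
    have "((\<lambda>h. exp (- ((1 + q) * h)) / (1 + q)) \<longlongrightarrow> 0 / (1 + q)) at_top"
    proof (rule tendsto_divide)
      show "((\<lambda>h. exp (- ((1 + q) * h))) \<longlongrightarrow> 0) at_top"
        using q by real_asymp
    qed (use q in auto)
    moreover have "((\<lambda>h::real. exp (- h)) \<longlongrightarrow> 0) at_top" by real_asymp
    ultimately have "(F \<longlongrightarrow> 0 / (1 + q) - 0) at_top"
      unfolding F_def by (intro tendsto_diff)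
    thus "(F \<longlongrightarrow> 0) at_top" by simp
  qed (use q in auto)
  also have "0 - F 0 = q / (1 + q)"
    using q by (simp add: F_def field_simps)
  finally show ?thesis .
qed

text \<open>The contribution of an interferer at \<open>fst p\<close> with mark
  \<open>snd p\<close>, normalised so that the attenuation is 1 at distance \<open>R\<close>. The
  interference is \<open>C * R powr (- \<alpha>)\<close> times the sum of these gains.\<close>

definition path_gain :: "real \<Rightarrow> real \<Rightarrow> (real^2) \<times> real \<Rightarrow> real" where
  "path_gain R \<alpha> p = R powr \<alpha> * norm (fst p) powr (- \<alpha>) * snd p"

lemma measurable_path_gain [measurable]: "path_gain R \<alpha> \<in> borel_measurable borel"
  unfolding path_gain_def[abs_def] borel_prod[symmetric] by measurable

lemma measurable_marked_density [measurable]: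
  "(\<lambda>p. ennreal (lam * indicator {x. R < norm x} (fst p) * exponential_density 1 (snd p)))
    \<in> borel_measurable (borel :: ((real^2) \<times> real) measure)"
proof -
  have [measurable]: "{x :: real^2. R < norm x} \<in> sets borel" by measurable
  show ?thesis unfolding borel_prod[symmetric] by measurable
qed

lemma sets_marked_intensity [measurable_cong, simp]: "sets (marked_intensity lam R) = sets borel"
  by (simp add: marked_intensity_def)

lemma sigma_finite_marked_intensity: "sigma_finite_measure (marked_intensity lam R)"
  unfolding marked_intensity_def
  by (rule sigma_finite_measure.sigma_finite_iff_density_finite[OF lborel.sigma_finite_measure_axioms, THEN iffD2]) simp_all

lemma nn_integral_marked_intensity:
  assumes [measurable]: "g \<in> borel_measurable borel"
  shows "(\<integral>\<^sup>+p. g p \<partial>marked_intensity lam R)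
    = (\<integral>\<^sup>+x. \<integral>\<^sup>+h. ennreal (lam * indicator {x. R < norm x} x * exponential_density 1 h) * g (x, h) \<partial>lborel \<partial>lborel)"
proof -
  have "(\<integral>\<^sup>+p. g p \<partial>marked_intensity lam R)
      = (\<integral>\<^sup>+p. ennreal (lam * indicator {x. R < norm x} (fst p) * exponential_density 1 (snd p)) * g p \<partial>lborel)"
    unfolding marked_intensity_def by (rule nn_integral_density) auto
  also have "\<dots> = (\<integral>\<^sup>+p. ennreal (lam * indicator {x. R < norm x} (fst p) * exponential_density 1 (snd p)) * g p
      \<partial>(lborel \<Otimes>\<^sub>M lborel))"
    unfolding lborel_prod ..
  also have "\<dots> = (\<integral>\<^sup>+x. \<integral>\<^sup>+h. ennreal (lam * indicator {x. R < norm x} x * exponential_density 1 h) * g (x, h) \<partial>lborel \<partial>lborel)"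
    by (subst lborel.nn_integral_fst[symmetric]) (simp_all add: lborel_prod)
  finally show ?thesis .
qed

text \<open>Integrating out the mark leaves \<open>k / (1 + k)\<close> as a function of the norm
  alone; polar coordinates then lead to the radial integral.\<close>

lemma nn_integral_interference:
  assumes lam: "lam > 0" and R: "R > 0" and \<alpha>: "\<alpha> > 2" and \<theta>: "\<theta> > 0"
  shows "(\<integral>\<^sup>+p. ennreal (1 - exp_neg (ennreal (\<theta> * path_gain R \<alpha> p))) \<partial>marked_intensity lam R)
    = ennreal (lam * (pi * R\<^sup>2 * (hyp2f1 (- 2 / \<alpha>) 1 (1 - 2 / \<alpha>) (- \<theta>) - 1)))" (is "_ = ennreal (lam * ?V)")
proof -
  define k where "k r = \<theta> * (R / r) powr \<alpha>" for r
  have k0: "0 \<le> k r" for r using \<theta> by (simp add: k_def)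
  have [measurable]: "k \<in> borel_measurable borel" unfolding k_def[abs_def] by measurable
  have gain: "\<theta> * path_gain R \<alpha> (x, h) = k (norm x) * h" if "R < norm x" for x h
    using that R by (simp add: path_gain_def k_def powr_divide powr_minus field_simps)
  have inner: "(\<integral>\<^sup>+h. ennreal (lam * indicator {x. R < norm x} x * exponential_density 1 h)
        * ennreal (1 - exp_neg (ennreal (\<theta> * path_gain R \<alpha> (x, h)))) \<partial>lborel)
      = ennreal lam * (indicator {R<..} (norm x) * ennreal (k (norm x) / (1 + k (norm x))))" for x :: "real^2"
  proof (cases "R < norm x")
    case True
    have "(\<integral>\<^sup>+h. ennreal (lam * indicator {x. R < norm x} x * exponential_density 1 h)
        * ennreal (1 - exp_neg (ennreal (\<theta> * path_gain R \<alpha> (x, h)))) \<partial>lborel)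
      = (\<integral>\<^sup>+h. ennreal lam * ennreal (exponential_density 1 h * (1 - exp (- (k (norm x) * h)))) \<partial>lborel)"
    proof (rule nn_integral_cong)
      fix h :: real
      show "ennreal (lam * indicator {x. R < norm x} x * exponential_density 1 h)
          * ennreal (1 - exp_neg (ennreal (\<theta> * path_gain R \<alpha> (x, h))))
        = ennreal lam * ennreal (exponential_density 1 h * (1 - exp (- (k (norm x) * h))))"
      \<comment> \<open>For a negative mark the exponential density is 0 and both sides vanish;
        otherwise the argument is nonnegative and \<open>ennreal\<close> does not truncate
        it.\<close>
      proof (cases "h < 0")
        case False
        hence "exp_neg (ennreal (\<theta> * path_gain R \<alpha> (x, h))) = exp (- (k (norm x) * h))"
          unfolding gain[OF True] using k0 by (intro exp_neg_ennreal) auto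
        thus ?thesis using True lam k0 False by (simp add: mult.assoc flip: ennreal_mult')
      qed (simp add: exponential_density_def)
    qed
    also have "\<dots> = ennreal lam * ennreal (k (norm x) / (1 + k (norm x)))"
      by (subst nn_integral_cmult) (auto simp: nn_integral_one_minus_exp_exponential[OF k0])
    finally show ?thesis using True by simp
  qed simp
  have "(\<integral>\<^sup>+p. ennreal (1 - exp_neg (ennreal (\<theta> * path_gain R \<alpha> p))) \<partial>marked_intensity lam R)
      = (\<integral>\<^sup>+x. ennreal lam * (indicator {R<..} (norm (x :: real^2)) * ennreal (k (norm x) / (1 + k (norm x)))) \<partial>lborel)"
    by (subst nn_integral_marked_intensity) (simp_all add: inner)
  also have "\<dots> = ennreal lam * (\<integral>\<^sup>+x. indicator {R<..} (norm (x :: real^2)) * ennreal (k (norm x) / (1 + k (norm x))) \<partial>lborel)"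
    by (rule nn_integral_cmult) measurable
  also have "(\<integral>\<^sup>+x. indicator {R<..} (norm (x :: real^2)) * ennreal (k (norm x) / (1 + k (norm x))) \<partial>lborel)
      = (\<integral>\<^sup>+r. ennreal (2 * pi * r) * indicator {0..} r * (indicator {R<..} r * ennreal (k r / (1 + k r))) \<partial>lborel)"
    by (rule nn_integral_norm_real2) measurable
  also have "\<dots> = (\<integral>\<^sup>+r. ennreal (2 * pi * r * (k r / (1 + k r))) * indicator {R..} r \<partial>lborel)"
  \<comment> \<open>\<open>{R<..}\<close> and \<open>{R..}\<close> differ in a single radius, a null
    set.\<close>
  proof (rule nn_integral_cong_AE)
    show "AE r in lborel. ennreal (2 * pi * r) * indicator {0..} r * (indicator {R<..} r * ennreal (k r / (1 + k r)))
        = ennreal (2 * pi * r * (k r / (1 + k r))) * indicator {R..} r"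
      using AE_lborel_singleton[of R]
    proof eventually_elim
      case (elim r)
      have "ennreal (2 * pi * r) * ennreal (k r / (1 + k r)) = ennreal (2 * pi * r * (k r / (1 + k r)))" if "R \<le> r"
        using that R k0[of r] by (intro ennreal_mult[symmetric]) auto
      thus ?case using R elim by (auto split: split_indicator simp del: times_divide_eq_right ennreal_mult'')
    qed
  qed
  also have "\<dots> = ennreal ?V"
    unfolding k_def by (rule nn_integral_radial_hyp2f1(1)[OF R \<alpha> \<theta>])
  finally show ?thesis
    using lam by (simp add: ennreal_mult')
qed

context poisson_process
begin

text \<open>Measurability must hold everywhere and not just up to a null set: \<^term>\<open>M\<close> need not be complete,
  and \<^const>\<open>measure\<close> is 0 on non-measurable sets.\<close>

lemma measurable_infsum_points:
  fixes f :: "'b \<Rightarrow> real"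
  assumes f: "f \<in> borel_measurable \<mu>"
  shows "(\<lambda>\<omega>. infsum f (\<Psi> \<omega>)) \<in> borel_measurable M"
proof -
  define Jp Jn where "Jp \<omega> = (\<integral>\<^sup>+p. ennreal (f p) \<partial>count_space (\<Psi> \<omega>))"
    and "Jn \<omega> = (\<integral>\<^sup>+p. ennreal (- f p) \<partial>count_space (\<Psi> \<omega>))" for \<omega>
  have [measurable]: "Jp \<in> borel_measurable M" "Jn \<in> borel_measurable M"
    unfolding Jp_def[abs_def] Jn_def[abs_def] using f
    by (auto intro!: measurable_nn_integral_points)
  \<comment> \<open>As a Lebesgue integral, the sum is the difference of its positive and negative
    parts, or the default 0 if one of them is infinite. This covers configurations with negative
    marks as well.\<close>
  have "infsum f (\<Psi> \<omega>) = (if Jp \<omega> \<noteq> \<infinity> \<and> Jn \<omega> \<noteq> \<infinity> then enn2real (Jp \<omega>) - enn2real (Jn \<omega>) else 0)" for \<omega>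
  proof (cases "integrable (count_space (\<Psi> \<omega>)) f")
    case True
    thus ?thesis
      by (simp add: infsum_eq_lebesgue_integral_count_space real_lebesgue_integral_def Jp_def Jn_def real_integrable_def)
  next
    case False
    hence "\<not> (Jp \<omega> \<noteq> \<infinity> \<and> Jn \<omega> \<noteq> \<infinity>)" by (simp add: real_integrable_def Jp_def Jn_def)
    thus ?thesis using False
      by (auto simp: infsum_eq_lebesgue_integral_count_space not_integrable_integral_eq)
  qed
  thus ?thesis by simp
qed

end

text \<open>Preimages under \<open>X\<close> lie in \<open>A\<close>, those under \<open>Y\<close>
  in \<open>B\<close>, and independence passes to smaller families. This turns the assumption on
  generated sigma-algebras into one on random variables.\<close>

lemma (in prob_space) indep_var_of_indep_set:
  assumes indep: "indep_set (sets A) (sets B)" and space: "space A = space M" "space B = space M"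
    and X: "X \<in> measurable A N" and Y: "Y \<in> measurable B N'"
  shows "indep_var N X N' Y"
proof -
  have ev: "sets A \<subseteq> events" "sets B \<subseteq> events"
    using indep_setD_ev1[OF indep] indep_setD_ev2[OF indep] .
  have pre: "X -` S \<inter> space M \<in> sets A" if "S \<in> sets N" for S
    using measurable_sets[OF X that] space by simp
  have pre': "Y -` S \<inter> space M \<in> sets B" if "S \<in> sets N'" for S
    using measurable_sets[OF Y that] space by simp
  have "X \<in> measurable M N"
    by (rule measurableI) (use pre ev measurable_space[OF X] space in auto)
  moreover have "Y \<in> measurable M N'"
    by (rule measurableI) (use pre' ev measurable_space[OF Y] space in auto)
  moreover have sX: "sigma_sets (space M) {X -` S \<inter> space M |S. S \<in> sets N} \<subseteq> sets A"
    unfolding space(1)[symmetric] by (rule sets.sigma_sets_subset) (use pre space in auto)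
  moreover have sY: "sigma_sets (space M) {Y -` S \<inter> space M |S. S \<in> sets N'} \<subseteq> sets B"
    unfolding space(2)[symmetric] by (rule sets.sigma_sets_subset) (use pre' space in auto)
  moreover have "indep_set (sigma_sets (space M) {X -` S \<inter> space M |S. S \<in> sets N})
      (sigma_sets (space M) {Y -` S \<inter> space M |S. S \<in> sets N'})"
    unfolding indep_set_def
  proof (rule indep_sets_mono_sets[OF indep[unfolded indep_set_def]])
    fix i
    show "(case i of True \<Rightarrow> sigma_sets (space M) {X -` S \<inter> space M |S. S \<in> sets N}
        | False \<Rightarrow> sigma_sets (space M) {Y -` S \<inter> space M |S. S \<in> sets N'})
      \<subseteq> (case i of True \<Rightarrow> sets A | False \<Rightarrow> sets B)"
      using sX sY by (cases i) simp_all
  qed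
  ultimately show ?thesis
    unfolding indep_var_eq by blast
qed

text \<open>For a fixed value \<open>y\<close> of \<open>Y\<close> the exponential tail gives the
  probability \<open>exp (- s) * exp_neg y\<close>; independence and Fubini average it over
  \<open>Y\<close>.\<close>

lemma (in prob_space) prob_exponential_exceeds_indep:
  fixes G :: "'a \<Rightarrow> real" and Y :: "'a \<Rightarrow> ennreal"
  assumes G: "distributed M lborel G (exponential_density 1)"
    and indep: "indep_var borel (\<lambda>\<omega>. ennreal (G \<omega>)) borel Y" and s: "0 \<le> s"
  shows "prob {\<omega>\<in>space M. ennreal s + Y \<omega> < ennreal (G \<omega>)} = exp (- s) * expectation (\<lambda>\<omega>. exp_neg (Y \<omega>))"
proof -
  let ?G = "\<lambda>\<omega>. ennreal (G \<omega>)"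
  have [measurable]: "G \<in> borel_measurable M" "Y \<in> borel_measurable M"
    using distributed_measurable[OF G] indep_var_rv2[OF indep] by auto
  interpret DG: prob_space "distr M borel ?G" by (rule prob_space_distr) simp
  interpret DY: prob_space "distr M borel Y" by (rule prob_space_distr) simp
  interpret pair_sigma_finite "distr M borel ?G" "distr M borel Y" ..
  define S where "S = {p :: ennreal \<times> ennreal. ennreal s + snd p < fst p}"
  have S: "S \<in> sets (borel \<Otimes>\<^sub>M borel)"
  proof -
    have "S = {p \<in> space (borel \<Otimes>\<^sub>M borel). ennreal s + snd p < fst p}"
      by (auto simp: S_def space_pair_measure)
    also have "\<dots> \<in> sets (borel \<Otimes>\<^sub>M borel)" by measurable
    finally show ?thesis .
  qed
  \<comment> \<open>At \<open>y = \<top>\<close> the slice is empty, in agreement with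
    \<open>exp_neg \<top> = 0\<close>. Truncating \<open>G\<close> at 0 is harmless because the
    threshold is nonnegative.\<close>
  have slice: "emeasure (distr M borel ?G) ((\<lambda>g. (g, y)) -` S) = ennreal (exp (- s) * exp_neg y)" for y
  proof (cases y)
    case (real r)
    have "ennreal s + y = ennreal (s + r)" using real s by simp
    hence "(\<lambda>g. (g, y)) -` S = {ennreal (s + r)<..}" by (auto simp: S_def)
    hence "emeasure (distr M borel ?G) ((\<lambda>g. (g, y)) -` S) = emeasure M (?G -` {ennreal (s + r)<..} \<inter> space M)"
      by (simp add: emeasure_distr)
    also have "?G -` {ennreal (s + r)<..} \<inter> space M = {\<omega>\<in>space M. s + r < G \<omega>}"
      using real s by (auto simp: ennreal_less_iff simp flip: ennreal_plus)
    also have "emeasure M \<dots> = ennreal (exp (- (s + r)))"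
      using exponential_distributedD_gt[OF G, of "s + r"] s real by (simp add: emeasure_eq_measure)
    also have "exp (- (s + r)) = exp (- s) * exp_neg y"
      using real by (simp add: exp_neg_ennreal flip: exp_add)
    finally show ?thesis .
  qed (simp add: S_def exp_neg_def vimage_def)
  have "ennreal (prob {\<omega>\<in>space M. ennreal s + Y \<omega> < ?G \<omega>})
      = emeasure (distr M (borel \<Otimes>\<^sub>M borel) (\<lambda>\<omega>. (?G \<omega>, Y \<omega>))) S"
  proof -
    have "(\<lambda>\<omega>. (?G \<omega>, Y \<omega>)) -` S \<inter> space M = {\<omega>\<in>space M. ennreal s + Y \<omega> < ?G \<omega>}"
      by (auto simp: S_def)
    thus ?thesis using S by (simp add: emeasure_distr emeasure_eq_measure)
  qed
  also have "distr M (borel \<Otimes>\<^sub>M borel) (\<lambda>\<omega>. (?G \<omega>, Y \<omega>)) = distr M borel ?G \<Otimes>\<^sub>M distr M borel Y"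
    using indep by (simp add: indep_var_distribution_eq)
  also have "emeasure \<dots> S = (\<integral>\<^sup>+y. emeasure (distr M borel ?G) ((\<lambda>g. (g, y)) -` S) \<partial>distr M borel Y)"
    by (rule emeasure_pair_measure_alt2) (use S in \<open>simp cong: sets_pair_measure_cong\<close>)
  also have "\<dots> = (\<integral>\<^sup>+\<omega>. ennreal (exp (- s) * exp_neg (Y \<omega>)) \<partial>M)"
    unfolding slice by (rule nn_integral_distr) auto
  also have "\<dots> = ennreal (expectation (\<lambda>\<omega>. exp (- s) * exp_neg (Y \<omega>)))"
    by (intro nn_integral_eq_integral integrable_const_bound[where B = "exp (- s)"]) (auto simp: abs_mult)
  finally show ?thesis by simp
qed

text \<open>Collecting \<open>G\<close> gives it the coefficient \<open>(a - g * b) * c\<close>,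
  whose positivity keeps the direction of the inequality.\<close>

lemma sinr_exceeds_iff:
  fixes a b c G I \<sigma> g :: real
  assumes "0 < b" "0 < c" "0 < g" "0 < a - g * b" "0 \<le> G" "0 \<le> I" "0 < \<sigma>"
  shows "g < a * c * G / (b * c * G + I + \<sigma>) \<longleftrightarrow> g / (a - g * b) / c * (I + \<sigma>) < G"
proof -
  have "0 < b * c * G + I + \<sigma>"
    using assms by (intro add_nonneg_pos add_nonneg_nonneg mult_nonneg_nonneg) auto
  hence "g < a * c * G / (b * c * G + I + \<sigma>) \<longleftrightarrow> g * (b * c * G + I + \<sigma>) < a * c * G"
    by (rule pos_less_divide_eq)
  also have "\<dots> \<longleftrightarrow> g * (I + \<sigma>) < G * ((a - g * b) * c)"
    by (simp add: algebra_simps)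
  also have "\<dots> \<longleftrightarrow> g * (I + \<sigma>) / ((a - g * b) * c) < G"
    using assms by (simp add: pos_divide_less_eq)
  finally show ?thesis by simp
qed

section \<open>Coverage in a marked Poisson field of interferers\<close>

context
  fixes lam R \<alpha> :: real and M :: "'a measure" and \<Psi> :: "'a \<Rightarrow> ((real^2) \<times> real) set"
  assumes lam: "lam > 0" and R: "R > 0" and \<alpha>: "\<alpha> > 2"
    and ppp: "poisson_pp M (marked_intensity lam R) \<Psi>"
begin

interpretation poisson_process "marked_intensity lam R" M \<Psi>
  by (intro poisson_process.intro poisson_process_axioms.intro sigma_finite_marked_intensity ppp)

lemma laplace_interference:
  assumes \<theta>: "\<theta> > 0"
  shows "(\<integral>\<omega>. exp_neg (\<integral>\<^sup>+p. ennreal (\<theta> * path_gain R \<alpha> p) \<partial>count_space (\<Psi> \<omega>)) \<partial>M)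
    = exp (- (lam * (pi * R\<^sup>2 * (hyp2f1 (- 2 / \<alpha>) 1 (1 - 2 / \<alpha>) (- \<theta>) - 1))))"
proof (rule laplace_functional)
  show "(\<lambda>p. ennreal (\<theta> * path_gain R \<alpha> p)) \<in> borel_measurable (marked_intensity lam R)"
    by measurable
  show "0 \<le> lam * (pi * R\<^sup>2 * (hyp2f1 (- 2 / \<alpha>) 1 (1 - 2 / \<alpha>) (- \<theta>) - 1))"
    using lam nn_integral_radial_hyp2f1(2)[OF R \<alpha> \<theta>] by simp
qed (rule nn_integral_interference[OF lam R \<alpha> \<theta>])

lemma nn_integral_scale_gain:
  assumes "\<theta> > 0"
  shows "(\<integral>\<^sup>+p. ennreal (\<theta> * path_gain R \<alpha> p) \<partial>count_space (\<Psi> \<omega>))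
    = ennreal \<theta> * (\<integral>\<^sup>+p. ennreal (path_gain R \<alpha> p) \<partial>count_space (\<Psi> \<omega>))"
  using assms by (simp add: ennreal_mult' nn_integral_cmult)

text \<open>The Laplace transform of the interference tends to 1 at the origin, which rules out
  an infinite interference.\<close>

lemma AE_interference_finite:
  "AE \<omega> in M. (\<integral>\<^sup>+p. ennreal (path_gain R \<alpha> p) \<partial>count_space (\<Psi> \<omega>)) < \<top>"
proof -
  define X where "X \<omega> = (\<integral>\<^sup>+p. ennreal (path_gain R \<alpha> p) \<partial>count_space (\<Psi> \<omega>))" for \<omega>
  have [measurable]: "X \<in> borel_measurable M"
    unfolding X_def[abs_def] by (rule measurable_nn_integral_points) measurable
  let ?S = "{\<omega>\<in>space M. X \<omega> < \<top>}"
  let ?L = "\<lambda>\<theta>. exp (- (lam * (pi * R\<^sup>2 * (hyp2f1 (- 2 / \<alpha>) 1 (1 - 2 / \<alpha>) (- \<theta>) - 1))))"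
  \<comment> \<open>Outcomes with infinite \<open>X\<close> contribute 0 to the Laplace transform
    and all others at most 1.\<close>
  have le: "?L \<theta> \<le> P.prob ?S" if "\<theta> > 0" for \<theta>
  proof -
    have "?L \<theta> = P.expectation (\<lambda>\<omega>. exp_neg (ennreal \<theta> * X \<omega>))"
      unfolding X_def nn_integral_scale_gain[OF that, symmetric] by (rule laplace_interference[OF that, symmetric])
    also have "\<dots> \<le> P.expectation (indicator ?S)"
    proof (rule integral_mono)
      show "integrable M (\<lambda>\<omega>. exp_neg (ennreal \<theta> * X \<omega>))"
        by (rule P.integrable_const_bound[where B = 1]) auto
      show "integrable M (indicator ?S :: 'a \<Rightarrow> real)"
        by (rule P.integrable_const_bound[where B = 1]) auto
      fix \<omega> assume "\<omega> \<in> space M"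
      thus "exp_neg (ennreal \<theta> * X \<omega>) \<le> indicator ?S \<omega>"
        using that by (cases "X \<omega> = \<top>") (auto simp: less_top exp_neg_def ennreal_mult_top)
    qed
    also have "\<dots> = P.prob ?S" by simp
    finally show ?thesis .
  qed
  have "((\<lambda>\<theta>. hyp2f1 (- 2 / \<alpha>) 1 (1 - 2 / \<alpha>) (- \<theta>)) \<longlongrightarrow> 1) (at_right 0)"
    using hyp2f1_tendsto_1[OF \<alpha>] by (rule tendsto_mono[rotated]) (simp add: at_le)
  hence "(?L \<longlongrightarrow> exp (- (lam * (pi * R\<^sup>2 * (1 - 1))))) (at_right 0)"
    by (intro tendsto_intros)
  hence "exp (- (lam * (pi * R\<^sup>2 * (1 - 1)))) \<le> P.prob ?S"
    by (rule tendsto_upperbound[OF _ eventually_mono[OF eventually_at_right_less le]]) simp_all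
  hence "P.prob ?S = 1" by (simp add: antisym)
  hence "AE \<omega> in M. \<omega> \<in> ?S" by (rule P.AE_prob_1)
  thus ?thesis by (auto simp: X_def)
qed

text \<open>The exponential density vanishes on negative marks, so they have intensity 0. This
  allows the real-valued interference to be compared with an integral of nonnegative terms.\<close>

lemma AE_marks_nonneg: "AE \<omega> in M. \<forall>p\<in>\<Psi> \<omega>. 0 \<le> snd p"
proof -
  have neg: "{p :: (real^2) \<times> real. snd p < 0} \<in> sets borel"
    by (intro borel_open open_Collect_less continuous_intros)
  have "emeasure (marked_intensity lam R) {p. snd p < 0}
      = (\<integral>\<^sup>+p. ennreal (lam * indicator {x. R < norm x} (fst p) * exponential_density 1 (snd p))
          * indicator {p. snd p < 0} p \<partial>(lborel :: ((real^2) \<times> real) measure))"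
    unfolding marked_intensity_def by (rule emeasure_density) (use neg in simp_all)
  also have "\<dots> = (\<integral>\<^sup>+p. 0 \<partial>(lborel :: ((real^2) \<times> real) measure))"
    by (intro nn_integral_cong) (auto simp: exponential_density_def split: split_indicator)
  finally have "emeasure (marked_intensity lam R) {p. snd p < 0} = 0" by simp
  from AE_no_points[OF _ this] neg
  have "AE \<omega> in M. \<Psi> \<omega> \<inter> {p. snd p < 0} = {}" by simp
  thus ?thesis by eventually_elim (force simp: not_less[symmetric])
qed

text \<open>Three forms of the interference are linked: the real sum \<open>I\<close>, the rescaled
  extended sum \<open>Z\<close> with \<open>I = c / \<theta> * Z\<close> almost surely, and a
  version \<open>Y\<close> of \<open>Z\<close> that depends on the counts alone and hence is
  independent of \<open>G\<close>.\<close>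

lemma coverage_probability:
  fixes G :: "'a \<Rightarrow> real"
  assumes pos: "0 < C" "0 < \<sigma>" "0 < b" "0 < g" "0 < a - g * b"
    and G: "distributed M lborel G (exponential_density 1)"
    and indep: "P.indep_set (sets (vimage_algebra (space M) G borel))
      (sets (vimage_algebra (space M) (pp_counts (marked_intensity lam R) \<Psi>)
        (pp_counts_space (marked_intensity lam R))))"
  defines "I \<equiv> \<lambda>\<omega>. \<Sum>\<^sub>\<infinity>p\<in>\<Psi> \<omega>. C * norm (fst p) powr (- \<alpha>) * snd p"
    and "c \<equiv> C * R powr (- \<alpha>)"
    and "\<theta> \<equiv> g / (a - g * b)"
  shows "P.prob {\<omega>\<in>space M. g < a * c * G \<omega> / (b * c * G \<omega> + I \<omega> + \<sigma>)}
    = exp (- (\<theta> / c * \<sigma>)) * exp (- (lam * (pi * R\<^sup>2 * (hyp2f1 (- 2 / \<alpha>) 1 (1 - 2 / \<alpha>) (- \<theta>) - 1))))"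
proof -
  have \<theta>: "\<theta> > 0" and c: "c > 0" using pos R by (auto simp: \<theta>_def c_def)
  define Z where "Z \<omega> = (\<integral>\<^sup>+p. ennreal (\<theta> * path_gain R \<alpha> p) \<partial>count_space (\<Psi> \<omega>))" for \<omega>
  have gain: "(\<lambda>p. ennreal (\<theta> * path_gain R \<alpha> p)) \<in> borel_measurable (marked_intensity lam R)"
    by measurable
  have [measurable]: "Z \<in> borel_measurable M"
    unfolding Z_def[abs_def] by (rule measurable_nn_integral_points[OF gain])
  have [measurable]: "G \<in> borel_measurable M"
    using distributed_measurable[OF G] by simp
  let ?V = "vimage_algebra (space M) (pp_counts (marked_intensity lam R) \<Psi>) (pp_counts_space (marked_intensity lam R))"
  obtain Y where Y: "Y \<in> borel_measurable ?V" "AE \<omega> in M. Y \<omega> = Z \<omega>"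
    using nn_integral_points_counts_version[OF gain] unfolding Z_def by blast
  have "G \<in> borel_measurable (vimage_algebra (space M) G borel)"
    by (rule measurable_vimage_algebra1) simp
  hence iv: "P.indep_var borel (\<lambda>\<omega>. ennreal (G \<omega>)) borel Y"
    by (intro P.indep_var_of_indep_set[OF indep _ _ _ Y(1)]) auto
  have [measurable]: "Y \<in> borel_measurable M"
    using P.indep_var_rv2[OF iv] .
  have gain_eq: "C * norm (fst p) powr (- \<alpha>) * snd p = c / \<theta> * (\<theta> * path_gain R \<alpha> p)" for p :: "(real^2) \<times> real"
    using \<theta> R by (simp add: c_def path_gain_def powr_minus field_simps)
  have "(\<lambda>p. C * norm (fst p) powr (- \<alpha>) * snd p) \<in> borel_measurable (marked_intensity lam R)"
    unfolding gain_eq by measurable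
  hence [measurable]: "I \<in> borel_measurable M"
    unfolding I_def by (rule measurable_infsum_points)
  \<comment> \<open>This includes divergent sums, for which both \<open>infsum\<close> and
    \<open>enn2real\<close> return 0.\<close>
  have I_Z: "I \<omega> = c / \<theta> * enn2real (Z \<omega>)" if "\<forall>p\<in>\<Psi> \<omega>. 0 \<le> snd p" for \<omega>
  proof -
    have "I \<omega> = enn2real (\<integral>\<^sup>+p. ennreal (c / \<theta> * (\<theta> * path_gain R \<alpha> p)) \<partial>count_space (\<Psi> \<omega>))"
      unfolding I_def infsum_eq_lebesgue_integral_count_space gain_eq
    proof (rule integral_eq_nn_integral)
      show "AE p in count_space (\<Psi> \<omega>). 0 \<le> c / \<theta> * (\<theta> * path_gain R \<alpha> p)"
        using that c \<theta> by (auto simp: AE_count_space path_gain_def)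
    qed simp
    also have "(\<integral>\<^sup>+p. ennreal (c / \<theta> * (\<theta> * path_gain R \<alpha> p)) \<partial>count_space (\<Psi> \<omega>))
        = (\<integral>\<^sup>+p. ennreal (c / \<theta>) * ennreal (\<theta> * path_gain R \<alpha> p) \<partial>count_space (\<Psi> \<omega>))"
      using c \<theta> by (intro nn_integral_cong ennreal_mult') simp
    also have "\<dots> = ennreal (c / \<theta>) * Z \<omega>"
      unfolding Z_def by (rule nn_integral_cmult) simp
    finally show ?thesis using c \<theta> by (simp add: enn2real_mult)
  qed
  have "P.prob {\<omega>\<in>space M. 0 < G \<omega>} = 1"
    using P.exponential_distributedD_gt[OF G, of 0] by simp
  hence "AE \<omega> in M. \<omega> \<in> {\<omega>\<in>space M. 0 < G \<omega>}" by (rule P.AE_prob_1)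
  moreover have "AE \<omega> in M. Z \<omega> < \<top>"
    using AE_interference_finite
    by eventually_elim (simp add: Z_def nn_integral_scale_gain[OF \<theta>] ennreal_mult_less_top)
  \<comment> \<open>The exceptional outcomes are those with \<open>G \<le> 0\<close>, infinite
    \<open>Z\<close>, \<open>Y\<close> different from \<open>Z\<close>, or a negative mark.\<close>
  ultimately have AE: "AE \<omega> in M. \<omega> \<in> {\<omega>\<in>space M. g < a * c * G \<omega> / (b * c * G \<omega> + I \<omega> + \<sigma>)}
      \<longleftrightarrow> \<omega> \<in> {\<omega>\<in>space M. ennreal (\<theta> / c * \<sigma>) + Y \<omega> < ennreal (G \<omega>)}"
    using Y(2) AE_marks_nonneg AE_space
  proof eventually_elim
    case (elim \<omega>)
    define z where "z = enn2real (Z \<omega>)"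
    have Yz: "Y \<omega> = ennreal z" and z: "0 \<le> z" using elim by (auto simp: z_def)
    have I: "I \<omega> = c / \<theta> * z" using elim by (simp add: I_Z z_def)
    have "g < a * c * G \<omega> / (b * c * G \<omega> + I \<omega> + \<sigma>) \<longleftrightarrow> \<theta> / c * (I \<omega> + \<sigma>) < G \<omega>"
      unfolding \<theta>_def
      by (rule sinr_exceeds_iff) (use pos c elim I z \<theta> in auto)
    also have "\<theta> / c * (I \<omega> + \<sigma>) = \<theta> / c * \<sigma> + z"
      unfolding I using c \<theta> by (simp add: field_simps)
    also have "\<theta> / c * \<sigma> + z < G \<omega> \<longleftrightarrow> ennreal (\<theta> / c * \<sigma>) + Y \<omega> < ennreal (G \<omega>)"
      unfolding Yz using c \<theta> pos z
      by (simp add: ennreal_less_iff flip: ennreal_plus)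
    finally show ?case using elim by simp
  qed
  have "P.prob {\<omega>\<in>space M. g < a * c * G \<omega> / (b * c * G \<omega> + I \<omega> + \<sigma>)}
      = P.prob {\<omega>\<in>space M. ennreal (\<theta> / c * \<sigma>) + Y \<omega> < ennreal (G \<omega>)}"
    by (rule P.finite_measure_eq_AE[OF AE]) measurable
  also have "\<dots> = exp (- (\<theta> / c * \<sigma>)) * P.expectation (\<lambda>\<omega>. exp_neg (Y \<omega>))"
    by (rule P.prob_exponential_exceeds_indep[OF G iv]) (use c \<theta> pos in auto)
  also have "P.expectation (\<lambda>\<omega>. exp_neg (Y \<omega>)) = P.expectation (\<lambda>\<omega>. exp_neg (Z \<omega>))"
    by (rule integral_cong_AE) (use Y(2) in auto)
  also have "\<dots> = exp (- (lam * (pi * R\<^sup>2 * (hyp2f1 (- 2 / \<alpha>) 1 (1 - 2 / \<alpha>) (- \<theta>) - 1))))"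
    unfolding Z_def by (rule laplace_interference[OF \<theta>])
  finally show ?thesis .
qed

end

theorem theorem3:
  fixes M :: "'a measure"
    and \<Psi> :: "'a \<Rightarrow> ((real^2) \<times> real) set"
    and G :: "'a \<Rightarrow> real"
    and lam_b r_c alpha_c P_t C_c sigma2 a_c a_t gth :: real
  assumes "lam_b > 0" "r_c > 0" "alpha_c > 2" "P_t > 0" "C_c > 0" "sigma2 > 0"
    and "a_c > 0" "a_t > 0" "a_c + a_t = 1" "gth > 0" "a_c - gth * a_t > 0"
    and ppp: "poisson_pp M (marked_intensity lam_b r_c) \<Psi>"
    and G_exp: "distributed M lborel G (exponential_density 1)"
    and G_indep: "prob_space.indep_set M (sets (vimage_algebra (space M) G borel))
                    (sets (vimage_algebra (space M) (pp_counts (marked_intensity lam_b r_c) \<Psi>)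
                       (pp_counts_space (marked_intensity lam_b r_c))))"
  shows
    "let I_c = (\<lambda>\<omega>. \<Sum>\<^sub>\<infinity>p\<in>\<Psi> \<omega>. P_t * C_c * norm (fst p) powr (- alpha_c) * snd p);
         gamma_c = (\<lambda>\<omega>. a_c * P_t * C_c * r_c powr (- alpha_c) * G \<omega> /
                          (a_t * P_t * C_c * r_c powr (- alpha_c) * G \<omega> + I_c \<omega> + sigma2));
         Xi3 = gth * sigma2 / ((a_c - gth * a_t) * P_t * C_c);
         Xi4 = pi * lam_b * (hyp2f1 (- 2 / alpha_c) 1 (1 - 2 / alpha_c) (- gth / (a_c - gth * a_t)) - 1)
     in measure M {\<omega>\<in>space M. gamma_c \<omega> > gth}
          = exp (- Xi3 * r_c powr alpha_c) * exp (- Xi4 * r_c ^ 2)"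
proof -
  have PC: "0 < P_t * C_c" using assms by simp
  \<comment> \<open>The left side is \<open>\<theta> / c * \<sigma>\<close> with
    \<open>c = P_t * C_c * r_c powr (- alpha_c)\<close>; dividing by \<open>c\<close> moves the
    power of \<open>r_c\<close> into the numerator.\<close>
  have "gth / (a_c - gth * a_t) / (P_t * C_c * r_c powr (- alpha_c)) * sigma2
      = gth * sigma2 / ((a_c - gth * a_t) * P_t * C_c) * r_c powr alpha_c"
    by (simp add: powr_minus divide_inverse mult_ac)
  moreover have "lam_b * (pi * r_c\<^sup>2 * (H - 1)) = pi * lam_b * (H - 1) * r_c ^ 2" for H
    by simp
  moreover have "- (gth / (a_c - gth * a_t)) = - gth / (a_c - gth * a_t)"
    by simp
  ultimately show ?thesis
    using coverage_probability[OF assms(1-3) ppp PC assms(6,8,10,11) G_exp G_indep]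
    unfolding Let_def by (simp only: mult.assoc mult_minus_left)
qed

end
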